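(* Let $(\Omega,\mathcal{F})$ be a Borel space, let $\mathfrak{P}$ be the set of all probability measures on $(\Omega,\mathcal{F})$, let $\mu$ be a probability measure on $\mathfrak{P}$ (a second order prior), and let $\hat{\mathbb{P}}(A)=\int_{\mathfrak{P}}\mathbb{P}(A)\,\mu(d\mathbb{P})$ for $A\in\mathcal{F}$. Let $\mathcal{H}=\mathcal{L}^1(\Omega,\mathcal{F},\hat{\mathbb{P}})$ with the $L^1(\hat{\mathbb{P}})$-norm topology $\tau$, let the pre-order be given by $$X\le Y\iff\mu\big(\{\mathbb{P}\in\mathfrak{P}:\mathbb{P}(X\le Y)=1\}\big)=1,$$ let $\mathcal{R}$ be the set of $R\in\mathcal{H}$ with $0\le R$ and $\mu(\{\mathbb{P}\in\mathfrak{P}:\mathbb{P}(R>0)>0\})>0$, and let $\mathcal{I}\subset\mathcal{H}$ be the linear subspace of net trades of a frictionless one-period or multi-period discrete-time financial market (see context). Then the financial market $(\mathcal{H},\tau,\le,\mathcal{I},\mathcal{R})$ is viable if and only if there is a martingale measure $\mathbb{Q}$ that has the form $$\mathbb{Q}(A)=\int_{\mathfrak{P}}\int_A D\,d\mathbb{P}\,\mu(d\mathbb{P}),\qquad A\in\mathcal{F},$$ for some state price density $D$.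
   Context: $\mathfrak{P}$ carries a $\sigma$-field for which the maps $\mathbb{P}\mapsto\mathbb{P}(A)$, $A\in\mathcal{F}$, are measurable. State price density: a measurable function $D:\Omega\to[0,\infty)$ (for which the displayed formula defines a probability measure). Net trades: there are a filtration $(\mathcal{F}_t)_{t=0}^T$ on $(\Omega,\mathcal{F})$ ($T\ge1$), an adapted $\mathbb{R}^J_+$-valued process $S=(S_t)_{t=0}^T$ (discounted prices, with a riskless bond with interest rate zero), and $\mathcal{I}$ is the set of $\ell\in\mathcal{H}$ of the form $\ell=\sum_{t=1}^T H_t\cdot(S_t-S_{t-1})$ with $H_t$ an $\mathcal{F}_{t-1}$-measurable $\mathbb{R}^J$-valued function; $\mathcal{I}$ is a linear subspace of $\mathcal{H}$. Agents: $\mathcal{A}$ is the set of complete and transitive binary relations $\preceq$ on $\mathcal{H}$ (with strict part $\prec$) that are (i) weakly monotone: $X\le Y$ implies $X\preceq Y$; (ii) convex: $\{Z\in\mathcal{H}: X\preceq Z\}$ is convex for every $X$; (iii) $\tau$-lower semi-continuous: if $X_n\to X$ in $\tau$ and $X_n\preceq Y$ for all $n$, then $X\preceq Y$. Viability: the market is viable if there is a family $\{\preceq_a\}_{a\in A}\subset\mathcal{A}$ such that $\ell\preceq_a 0$ for every $a\in A$ and $\ell\in\mathcal{I}$, and for every $R\in\mathcal{R}$ there is $a\in A$ with $0\prec_a R$. Martingale measure: a probability measure $\mathbb{Q}$ on $(\Omega,\mathcal{F})$ such that $X\mapsto\mathbb{E}_{\mathbb{Q}}[X]$ is a well-defined $\tau$-continuous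 linear functional on $\mathcal{H}$, positive with respect to $\le$, with $\mathbb{E}_{\mathbb{Q}}[\ell]\le 0$ for all $\ell\in\mathcal{I}$ (equivalently $\mathbb{E}_{\mathbb{Q}}[\ell]=0$ for all $\ell\in\mathcal{I}$, since $\mathcal{I}$ is a linear subspace).
   Formalization: "Positive with respect to ≤" for a martingale measure is read as also strictly positive: E_Q[X] > 0 whenever 0 ≤ X and not X ≤ 0 (full support); with mere nonnegativity the "if" direction is false. *)

theory Defs
  imports "HOL-Probability.Probability"
begin

section \<open>Viability of an abstract financial market\<close>

text \<open>
  Claims are functions \<open>'a \<Rightarrow> real\<close>. A market consists of a set \<open>H\<close> of claims, a topology
  \<open>\<tau>\<close> on \<open>H\<close>, a pre-order \<open>le\<close> on \<open>H\<close>, a set \<open>I\<close> of net trades and a set \<open>R\<close> of relevant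
  claims. Relations are predicates; only their values on \<open>H\<close> matter.
\<close>

definition agents ::
  "('a \<Rightarrow> real) set \<Rightarrow> ('a \<Rightarrow> real) topology \<Rightarrow> (('a \<Rightarrow> real) \<Rightarrow> ('a \<Rightarrow> real) \<Rightarrow> bool)
    \<Rightarrow> (('a \<Rightarrow> real) \<Rightarrow> ('a \<Rightarrow> real) \<Rightarrow> bool) set" where
  "agents H \<tau> le = {pref.
     (\<forall>X\<in>H. \<forall>Y\<in>H. pref X Y \<or> pref Y X) \<and>
     transp_on H pref \<and>
     (\<forall>X\<in>H. \<forall>Y\<in>H. le X Y \<longrightarrow> pref X Y) \<and>
     (\<forall>X\<in>H. \<forall>Y\<in>H. \<forall>Z\<in>H. \<forall>u\<in>{0..1}. pref X Y \<longrightarrow> pref X Z \<longrightarrow>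
        pref X (\<lambda>\<omega>. u * Y \<omega> + (1 - u) * Z \<omega>)) \<and>
     (\<forall>Xs X. \<forall>Y\<in>H. range Xs \<subseteq> H \<longrightarrow> limitin \<tau> Xs X sequentially \<longrightarrow>
        (\<forall>n. pref (Xs n) Y) \<longrightarrow> pref X Y)}"

text \<open>A family of agents is represented by the set of its members.\<close>

definition viable ::
  "('a \<Rightarrow> real) set \<Rightarrow> ('a \<Rightarrow> real) topology \<Rightarrow> (('a \<Rightarrow> real) \<Rightarrow> ('a \<Rightarrow> real) \<Rightarrow> bool)
    \<Rightarrow> ('a \<Rightarrow> real) set \<Rightarrow> ('a \<Rightarrow> real) set \<Rightarrow> bool" where
  "viable H \<tau> le I R \<longleftrightarrow>
     (\<exists>\<A>\<subseteq>agents H \<tau> le.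
        (\<forall>pref\<in>\<A>. \<forall>l\<in>I. pref l (\<lambda>_. 0)) \<and>
        (\<forall>X\<in>R. \<exists>pref\<in>\<A>. pref (\<lambda>_. 0) X \<and> \<not> pref X (\<lambda>_. 0)))"

text \<open>
  Positivity of the functional \<open>X \<mapsto> E\<^sub>Q[X]\<close> is understood with respect to \<open>le\<close> and its strict
  part: nonnegative for \<open>0 \<le> X\<close> and strictly positive for \<open>0 < X\<close>. If only nonnegativity were
  demanded, a martingale measure vanishing on a relevant claim would be admitted, and its existence
  would not exclude arbitrage: on two equally likely states, the price path \<open>S\<^sub>0 = 1\<close>,
  \<open>S\<^sub>1 = (1, 2)\<close> is a martingale under the Dirac measure at the first state, while
  \<open>S\<^sub>1 - S\<^sub>0 = (0, 1)\<close> is both a net trade and relevant.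
\<close>

definition martingale_measure ::
  "'a measure \<Rightarrow> ('a \<Rightarrow> real) set \<Rightarrow> ('a \<Rightarrow> real) topology
    \<Rightarrow> (('a \<Rightarrow> real) \<Rightarrow> ('a \<Rightarrow> real) \<Rightarrow> bool) \<Rightarrow> ('a \<Rightarrow> real) set \<Rightarrow> 'a measure \<Rightarrow> bool" where
  "martingale_measure M H \<tau> le I Q \<longleftrightarrow>
     prob_space Q \<and> sets Q = sets M \<and>
     (\<forall>X\<in>H. integrable Q X) \<and>
     continuous_map \<tau> euclideanreal (\<lambda>X. \<integral>\<omega>. X \<omega> \<partial>Q) \<and>
     (\<forall>X\<in>H. le (\<lambda>_. 0) X \<longrightarrow> 0 \<le> (\<integral>\<omega>. X \<omega> \<partial>Q)) \<and>
     (\<forall>X\<in>H. le (\<lambda>_. 0) X \<longrightarrow> \<not> le X (\<lambda>_. 0) \<longrightarrow> 0 < (\<integral>\<omega>. X \<omega> \<partial>Q)) \<and>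
     (\<forall>l\<in>I. (\<integral>\<omega>. l \<omega> \<partial>Q) \<le> 0)"


section \<open>Second order priors\<close>

text \<open>
  Throughout, \<open>M\<close> only contributes the measurable space \<open>(\<Omega>, \<F>) = (space M, sets M)\<close>, and the
  set of all probability measures on it is \<^term>\<open>space (prob_algebra M)\<close>.
\<close>

definition standard_borel_space :: "'a measure \<Rightarrow> bool" where
  "standard_borel_space M \<longleftrightarrow>
     (\<exists>B\<in>sets (borel :: real measure). \<exists>f g.
        f \<in> measurable M (restrict_space borel B) \<and>
        g \<in> measurable (restrict_space borel B) M \<and>
        (\<forall>\<omega>\<in>space M. g (f \<omega>) = \<omega>) \<and> (\<forall>y\<in>B. f (g y) = y))"

text \<open>
  The \<open>\<sigma>\<close>-field on the set of probability measures may be any one that makes the evaluations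
  measurable, not just the smallest one.
\<close>

definition second_order_prior :: "'a measure \<Rightarrow> 'a measure measure \<Rightarrow> bool" where
  "second_order_prior M \<mu> \<longleftrightarrow>
     prob_space \<mu> \<and> space \<mu> = space (prob_algebra M) \<and>
     (\<forall>A\<in>sets M. (\<lambda>P. measure P A) \<in> borel_measurable \<mu>)"

definition mixture :: "'a measure \<Rightarrow> 'a measure measure \<Rightarrow> 'a measure" where
  "mixture M \<mu> = measure_of (space M) (sets M) (\<lambda>A. \<integral>\<^sup>+P. emeasure P A \<partial>\<mu>)"

lemma space_mixture [simp]: "space (mixture M \<mu>) = space M"
  by (simp add: mixture_def)

lemma sets_mixture [simp, measurable_cong]: "sets (mixture M \<mu>) = sets M"
  by (simp add: mixture_def)

lemma emeasure_mixture:
  assumes "second_order_prior M \<mu>" "A \<in> sets M"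
  shows "emeasure (mixture M \<mu>) A = (\<integral>\<^sup>+P. emeasure P A \<partial>\<mu>)"
proof (rule emeasure_measure_of[OF mixture_def])
  have prob: "prob_space P" "sets P = sets M" if "P \<in> space \<mu>" for P
    using that assms(1) by (auto simp: second_order_prior_def space_prob_algebra)
  have meas: "(\<lambda>P. emeasure P B) \<in> borel_measurable \<mu>" if "B \<in> sets M" for B
  proof -
    have "(\<lambda>P. ennreal (measure P B)) \<in> borel_measurable \<mu>"
      using assms(1) that by (auto simp: second_order_prior_def)
    also have "?this \<longleftrightarrow> ?thesis"
      using prob(1)
      by (intro measurable_cong)
         (metis finite_measure.emeasure_eq_measure prob_space.finite_measure)
    finally show ?thesis .
  qed
  show "sets M \<subseteq> Pow (space M)" by (rule sets.space_closed)
  show "A \<in> sets (mixture M \<mu>)" using assms(2) by simp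
  show "positive (sets (mixture M \<mu>)) (\<lambda>A. \<integral>\<^sup>+P. emeasure P A \<partial>\<mu>)"
    by (simp add: positive_def)
  show "countably_additive (sets (mixture M \<mu>)) (\<lambda>A. \<integral>\<^sup>+P. emeasure P A \<partial>\<mu>)"
  proof (rule countably_additiveI)
    fix B :: "nat \<Rightarrow> 'a set"
    assume B: "range B \<subseteq> sets (mixture M \<mu>)" "disjoint_family B"
    then have "B i \<in> sets M" for i by auto
    then have "(\<Sum>i. \<integral>\<^sup>+P. emeasure P (B i) \<partial>\<mu>) = (\<integral>\<^sup>+P. (\<Sum>i. emeasure P (B i)) \<partial>\<mu>)"
      by (intro nn_integral_suminf[symmetric] meas)
    also have "\<dots> = (\<integral>\<^sup>+P. emeasure P (\<Union>i. B i) \<partial>\<mu>)"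
      using B prob(2) by (intro nn_integral_cong suminf_emeasure) auto
    finally show "(\<Sum>i. \<integral>\<^sup>+P. emeasure P (B i) \<partial>\<mu>) = (\<integral>\<^sup>+P. emeasure P (\<Union>i. B i) \<partial>\<mu>)" .
  qed
qed

text \<open>
  The values of a claim outside \<^term>\<open>space N\<close> are immaterial, and claims are functions rather
  than equivalence classes; accordingly the topology below comes from a seminorm.
\<close>

definition L1_space :: "'a measure \<Rightarrow> ('a \<Rightarrow> real) set" where
  "L1_space N = {X. integrable N X}"

definition L1_topology :: "'a measure \<Rightarrow> ('a \<Rightarrow> real) topology" where
  "L1_topology N = topology (\<lambda>U. U \<subseteq> L1_space N \<and>
     (\<forall>X\<in>U. \<exists>\<epsilon>>0. \<forall>Y\<in>L1_space N. (\<integral>\<omega>. \<bar>Y \<omega> - X \<omega>\<bar> \<partial>N) < \<epsilon> \<longrightarrow> Y \<in> U))"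

lemma openin_L1_topology:
  "openin (L1_topology N) U \<longleftrightarrow> U \<subseteq> L1_space N \<and>
     (\<forall>X\<in>U. \<exists>\<epsilon>>0. \<forall>Y\<in>L1_space N. (\<integral>\<omega>. \<bar>Y \<omega> - X \<omega>\<bar> \<partial>N) < \<epsilon> \<longrightarrow> Y \<in> U)"
proof -
  let ?op = "\<lambda>U. U \<subseteq> L1_space N \<and>
     (\<forall>X\<in>U. \<exists>\<epsilon>>0. \<forall>Y\<in>L1_space N. (\<integral>\<omega>. \<bar>Y \<omega> - X \<omega>\<bar> \<partial>N) < \<epsilon> \<longrightarrow> Y \<in> U)"
  have "istopology ?op"
    unfolding istopology_def
  proof (intro conjI allI impI ballI)
    fix U V X assume U: "?op U" and V: "?op V" and X: "X \<in> U \<inter> V"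
    obtain d where d: "d > 0" "\<forall>Y\<in>L1_space N. (\<integral>\<omega>. \<bar>Y \<omega> - X \<omega>\<bar> \<partial>N) < d \<longrightarrow> Y \<in> U"
      using U X by (meson IntD1)
    obtain e where e: "e > 0" "\<forall>Y\<in>L1_space N. (\<integral>\<omega>. \<bar>Y \<omega> - X \<omega>\<bar> \<partial>N) < e \<longrightarrow> Y \<in> V"
      using V X by (meson IntD2)
    show "\<exists>\<epsilon>>0. \<forall>Y\<in>L1_space N. (\<integral>\<omega>. \<bar>Y \<omega> - X \<omega>\<bar> \<partial>N) < \<epsilon> \<longrightarrow> Y \<in> U \<inter> V"
      using d e by (intro exI[of _ "min d e"]) auto
  next
    fix \<K> X assume K: "\<forall>K\<in>\<K>. ?op K" and "X \<in> \<Union>\<K>"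
    then obtain K where "K \<in> \<K>" "X \<in> K" by blast
    with K obtain d where "d > 0" "\<forall>Y\<in>L1_space N. (\<integral>\<omega>. \<bar>Y \<omega> - X \<omega>\<bar> \<partial>N) < d \<longrightarrow> Y \<in> K"
      by meson
    with \<open>K \<in> \<K>\<close> show "\<exists>\<epsilon>>0. \<forall>Y\<in>L1_space N. (\<integral>\<omega>. \<bar>Y \<omega> - X \<omega>\<bar> \<partial>N) < \<epsilon> \<longrightarrow> Y \<in> \<Union>\<K>"
      by (intro exI[of _ d]) auto
  qed auto
  then show ?thesis
    by (simp add: L1_topology_def topology_inverse')
qed

lemma topspace_L1_topology [simp]: "topspace (L1_topology N) = L1_space N"
proof
  show "topspace (L1_topology N) \<subseteq> L1_space N"
    by (auto simp: topspace_def openin_L1_topology)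
  have "openin (L1_topology N) (L1_space N)"
    unfolding openin_L1_topology by (auto intro: exI[of _ 1])
  then show "L1_space N \<subseteq> topspace (L1_topology N)"
    by (rule openin_subset)
qed

definition prior_le ::
  "'a measure \<Rightarrow> 'a measure measure \<Rightarrow> ('a \<Rightarrow> real) \<Rightarrow> ('a \<Rightarrow> real) \<Rightarrow> bool" where
  "prior_le M \<mu> X Y \<longleftrightarrow>
     measure \<mu> {P \<in> space \<mu>. measure P {\<omega> \<in> space M. X \<omega> \<le> Y \<omega>} = 1} = 1"

definition relevant_claims :: "'a measure \<Rightarrow> 'a measure measure \<Rightarrow> ('a \<Rightarrow> real) set" where
  "relevant_claims M \<mu> = {R \<in> L1_space (mixture M \<mu>). prior_le M \<mu> (\<lambda>_. 0) R \<and>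
     measure \<mu> {P \<in> space \<mu>. measure P {\<omega> \<in> space M. R \<omega> > 0} > 0} > 0}"


section \<open>Discrete-time frictionless market\<close>

definition filtration_upto :: "'a measure \<Rightarrow> nat \<Rightarrow> (nat \<Rightarrow> 'a measure) \<Rightarrow> bool" where
  "filtration_upto M T F \<longleftrightarrow>
     (\<forall>t\<le>T. subalgebra M (F t)) \<and> (\<forall>s t. s \<le> t \<longrightarrow> t \<le> T \<longrightarrow> subalgebra (F t) (F s))"

definition price_process ::
  "'a measure \<Rightarrow> nat \<Rightarrow> (nat \<Rightarrow> 'a measure) \<Rightarrow> (nat \<Rightarrow> 'a \<Rightarrow> real ^ 'j) \<Rightarrow> bool" where
  "price_process M T F S \<longleftrightarrow>
     (\<forall>t\<le>T. S t \<in> borel_measurable (F t)) \<and>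
     (\<forall>t\<le>T. \<forall>\<omega>\<in>space M. \<forall>j. 0 \<le> S t \<omega> $ j)"

text \<open>
  Prices are discounted, so the position in the riskless bond (interest rate zero) does not
  contribute to the gains.
\<close>

definition net_trades ::
  "'a measure \<Rightarrow> ('a \<Rightarrow> real) set \<Rightarrow> nat \<Rightarrow> (nat \<Rightarrow> 'a measure) \<Rightarrow> (nat \<Rightarrow> 'a \<Rightarrow> real ^ 'j)
    \<Rightarrow> ('a \<Rightarrow> real) set" where
  "net_trades M H T F S = {l \<in> H. \<exists>\<theta> :: nat \<Rightarrow> 'a \<Rightarrow> real ^ 'j.
     (\<forall>t\<in>{1..T}. \<theta> t \<in> borel_measurable (F (t - 1))) \<and>
     (\<forall>\<omega>\<in>space M. l \<omega> = (\<Sum>t=1..T. \<theta> t \<omega> \<bullet> (S t \<omega> - S (t - 1) \<omega>)))}"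


section \<open>State price density\<close>

definition state_price_density ::
  "'a measure \<Rightarrow> 'a measure measure \<Rightarrow> 'a measure \<Rightarrow> ('a \<Rightarrow> real) \<Rightarrow> bool" where
  "state_price_density M \<mu> Q D \<longleftrightarrow>
     D \<in> borel_measurable M \<and> (\<forall>\<omega>\<in>space M. 0 \<le> D \<omega>) \<and>
     (\<forall>A\<in>sets M. emeasure Q A = (\<integral>\<^sup>+P. (\<integral>\<^sup>+\<omega>\<in>A. ennreal (D \<omega>) \<partial>P) \<partial>\<mu>))"

end

(* With N the mixture of the prior, X \<le> Y means X \<le> Y N-almost everywhere, and the
   relevant claims are the N-nontrivial nonnegative integrable ones.

   A martingale measure Q supports the market with a single agent, who ranks claims by their
   Q-expectation.

   Conversely, viability keeps each relevant claim R at a positive L1-distance from the cone of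
   claims dominated by net trades (no free lunch); this uses only monotonicity, transitivity and
   lower semi-continuity of the agents. Hahn-Banach separates R from the cone by a functional
   bounded by the L1-norm; by Radon-Nikodym it is integration against a density D with
   0 \<le> D \<le> 1. The pricing densities so obtained are closed under countable convex
   combinations, so one whose support has maximal measure is positive almost everywhere
   (exhaustion argument of Kreps and Yan). Normalising it gives Q. *)

theory Submission
  imports Defs "HOL-Library.Function_Algebras"
begin

section \<open>Separation of a point from a convex cone\<close>

text \<open>The separation works with seminorms alone: the L1-distance to the cone is itself
  sublinear, so a linear functional below it that touches it at R already separates, and no closure
  of the cone is formed. Claims are functions, not classes, and \<open>L1_space\<close> is a subset
  of a function type; hence the Hahn-Banach part is phrased relative to a subspace \<open>V\<close>.
  The obstacle is that a density obtained from one relevant claim may vanish where another one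
  lives, whereas \<open>martingale_measure\<close> requires strict positivity on all of them, in
  general an uncountable family. The common bound 1 on the densities is what makes countable
  combinations harmless: they stay below 1, and since the terms are dominated by geometric multiples
  of \<open>|l|\<close>, the inequality for each net trade \<open>l\<close> survives
  summation.\<close>

definition sublinear_on :: "'v::real_vector set \<Rightarrow> ('v \<Rightarrow> real) \<Rightarrow> bool" where
  "sublinear_on V p \<longleftrightarrow>
     (\<forall>x\<in>V. \<forall>y\<in>V. p (x + y) \<le> p x + p y) \<and> (\<forall>c\<ge>0. \<forall>x\<in>V. p (c *\<^sub>R x) \<le> c * p x)"

lemma sublinear_onI:
  assumes "\<And>x y. x \<in> V \<Longrightarrow> y \<in> V \<Longrightarrow> p (x + y) \<le> p x + p y"
    and "\<And>c x. 0 \<le> c \<Longrightarrow> x \<in> V \<Longrightarrow> p (c *\<^sub>R x) \<le> c * p x"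
  shows "sublinear_on V p"
  using assms by (simp add: sublinear_on_def)

section \<open>The Hahn-Banach theorem on a subspace, by minimal sublinear functionals\<close>

context
  fixes V :: "'v::real_vector set"
  assumes V: "subspace V"
begin

lemma sublinear_on_0:
  assumes "sublinear_on V p"
  shows "p 0 = 0"
proof (rule antisym)
  have "p (0 *\<^sub>R 0) \<le> 0 * p 0" "p (0 + 0) \<le> p 0 + p 0"
    using assms subspace_0[OF V] unfolding sublinear_on_def by blast+
  then show "p 0 \<le> 0" "0 \<le> p 0" by simp_all
qed

text \<open>Only \<open>\<le>\<close> is part of \<open>sublinear_on\<close>; for
  \<open>c > 0\<close>, scaling back by \<open>inverse c\<close> gives the reverse
  inequality.\<close>

lemma sublinear_on_scale:
  assumes p: "sublinear_on V p" and "0 \<le> c" "x \<in> V"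
  shows "p (c *\<^sub>R x) = c * p x"
proof (cases "c = 0")
  case True
  then show ?thesis using sublinear_on_0[OF p] by simp
next
  case False
  have "p (inverse c *\<^sub>R c *\<^sub>R x) \<le> inverse c * p (c *\<^sub>R x)"
    using p subspace_scale[OF V \<open>x \<in> V\<close>] \<open>0 \<le> c\<close> unfolding sublinear_on_def
    by (simp del: scaleR_scaleR)
  then have "c * p x \<le> p (c *\<^sub>R x)"
    using False \<open>0 \<le> c\<close> by (simp add: field_simps)
  moreover have "p (c *\<^sub>R x) \<le> c * p x"
    using assms by (simp add: sublinear_on_def)
  ultimately show ?thesis by simp
qed

lemma sublinear_on_uminus:
  assumes p: "sublinear_on V p" and "x \<in> V"
  shows "- p (- x) \<le> p x"
proof -
  have "p (x + (- x)) \<le> p x + p (- x)"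
    using assms subspace_neg[OF V] unfolding sublinear_on_def by blast
  then show ?thesis using sublinear_on_0[OF p] by simp
qed

text \<open>The infimum of \<open>p (x + t y) - t * p y\<close> over \<open>t \<ge> 0\<close> is the
  largest sublinear function below \<open>p\<close> that is at most \<open>- p y\<close> at
  \<open>- y\<close>. It serves twice: it forces minimal functionals to be odd, and it pins down the
  value at \<open>y\<close> in \<open>hahn_banach_at\<close>.\<close>

lemma sublinear_on_lower_at:
  assumes p: "sublinear_on V p" and y: "y \<in> V"
  obtains q where "sublinear_on V q" "\<And>x. x \<in> V \<Longrightarrow> q x \<le> p x" "q (- y) \<le> - p y"
proof
  define q where "q x = (INF t\<in>{0..}. p (x + t *\<^sub>R y) - t * p y)" for x
  have ty: "t *\<^sub>R y \<in> V" for t by (rule subspace_scale[OF V y])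
  \<comment> \<open>A lower bound that does not depend on \<open>t\<close>: without it the
    real-valued \<open>INF\<close> would carry no information.\<close>
  have "- p (- x) \<le> p (x + t *\<^sub>R y) - t * p y" if "x \<in> V" "0 \<le> t" for x t
  proof -
    have "p ((x + t *\<^sub>R y) + (- x)) \<le> p (x + t *\<^sub>R y) + p (- x)"
      using p that ty subspace_add[OF V] subspace_neg[OF V] unfolding sublinear_on_def by blast
    then show ?thesis
      using sublinear_on_scale[OF p that(2) y] by simp
  qed
  then have bdd: "bdd_below ((\<lambda>t. p (x + t *\<^sub>R y) - t * p y) ` {0..})" if "x \<in> V" for x
    using that by (intro bdd_belowI2) auto
  have q_le: "q x \<le> p (x + t *\<^sub>R y) - t * p y" if "x \<in> V" "0 \<le> t" for x t
    unfolding q_def using that by (intro cINF_lower bdd) auto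
  show "q x \<le> p x" if "x \<in> V" for x
    using q_le[of x 0] that by simp
  show "q (- y) \<le> - p y"
    using q_le[of "- y" 1] subspace_neg[OF V y] sublinear_on_0[OF p] by simp
  have ge_q: "m \<le> q x" if "\<And>t. 0 \<le> t \<Longrightarrow> m \<le> p (x + t *\<^sub>R y) - t * p y" for m x
    unfolding q_def using that by (intro cINF_greatest) auto
  show "sublinear_on V q"
  proof (rule sublinear_onI)
    fix x z assume x: "x \<in> V" and z: "z \<in> V"
    \<comment> \<open>The two infima are taken one at a time, over \<open>s\<close> with
      \<open>t\<close> fixed and afterwards over \<open>t\<close>; the parameters add up to the
      admissible \<open>s + t\<close>.\<close>
    have "q (x + z) - (p (z + t *\<^sub>R y) - t * p y) \<le> q x" if "0 \<le> t" for t
    proof (rule ge_q)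
      fix s :: real assume "0 \<le> s"
      have "q (x + z) \<le> p (x + z + (s + t) *\<^sub>R y) - (s + t) * p y"
        using \<open>0 \<le> s\<close> that x z by (intro q_le subspace_add[OF V]) auto
      also have "x + z + (s + t) *\<^sub>R y = (x + s *\<^sub>R y) + (z + t *\<^sub>R y)"
        by (simp add: algebra_simps)
      also have "p \<dots> \<le> p (x + s *\<^sub>R y) + p (z + t *\<^sub>R y)"
        using p x z ty subspace_add[OF V] unfolding sublinear_on_def by blast
      finally show "q (x + z) - (p (z + t *\<^sub>R y) - t * p y) \<le> p (x + s *\<^sub>R y) - s * p y"
        by (simp add: algebra_simps)
    qed
    then have "q (x + z) - q x \<le> q z"
      by (intro ge_q) (simp add: algebra_simps)
    then show "q (x + z) \<le> q x + q z" by simp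
  next
    fix c :: real and x assume c: "0 \<le> c" and x: "x \<in> V"
    show "q (c *\<^sub>R x) \<le> c * q x"
    proof (cases "c = 0")
      case True
      then show ?thesis using q_le[of 0 0] subspace_0[OF V] sublinear_on_0[OF p] by simp
    next
      case False
      have "q (c *\<^sub>R x) / c \<le> q x"
      proof (rule ge_q)
        fix t :: real assume "0 \<le> t"
        have "q (c *\<^sub>R x) \<le> p (c *\<^sub>R x + (c * t) *\<^sub>R y) - (c * t) * p y"
          using c \<open>0 \<le> t\<close> x by (intro q_le subspace_scale[OF V]) auto
        also have "c *\<^sub>R x + (c * t) *\<^sub>R y = c *\<^sub>R (x + t *\<^sub>R y)"
          by (simp add: algebra_simps)
        also have "p \<dots> = c * p (x + t *\<^sub>R y)"
          using c x ty by (intro sublinear_on_scale[OF p] subspace_add[OF V])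
        finally show "q (c *\<^sub>R x) / c \<le> p (x + t *\<^sub>R y) - t * p y"
          using c False by (simp add: field_simps)
      qed
      then show ?thesis using c False by (simp add: field_simps)
    qed
  qed
qed

text \<open>Lowering a minimal \<open>p\<close> at \<open>y\<close> gives nothing smaller, so
  \<open>p (- y) \<le> - p y\<close> and \<open>p\<close> is odd. Oddness reverses subadditivity and
  extends homogeneity to negative \<open>c\<close>.\<close>

lemma minimal_sublinear_on_linear:
  assumes p: "sublinear_on V p"
    and minimal: "\<forall>q. sublinear_on V q \<longrightarrow> (\<forall>x\<in>V. q x \<le> p x) \<longrightarrow> (\<forall>x\<in>V. p x \<le> q x)"
  shows "x \<in> V \<Longrightarrow> y \<in> V \<Longrightarrow> p (x + y) = p x + p y"
    and "x \<in> V \<Longrightarrow> p (c *\<^sub>R x) = c * p x"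
proof -
  have odd: "p (- y) = - p y" if y: "y \<in> V" for y
  proof (rule antisym)
    obtain q where "sublinear_on V q" "\<And>x. x \<in> V \<Longrightarrow> q x \<le> p x" "q (- y) \<le> - p y"
      using sublinear_on_lower_at[OF p y] by blast
    then show "p (- y) \<le> - p y"
      using minimal subspace_neg[OF V y] by (meson order_trans)
    show "- p y \<le> p (- y)"
      using sublinear_on_uminus[OF p subspace_neg[OF V y]] by simp
  qed
  show "p (x + y) = p x + p y" if xy: "x \<in> V" "y \<in> V" for x y
  proof (rule antisym)
    show "p (x + y) \<le> p x + p y"
      using p xy by (simp add: sublinear_on_def)
    have "p ((x + y) + (- y)) \<le> p (x + y) + p (- y)"
      using p xy subspace_add[OF V] subspace_neg[OF V] unfolding sublinear_on_def by blast
    then show "p x + p y \<le> p (x + y)"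
      using odd[OF xy(2)] by simp
  qed
  show "p (c *\<^sub>R x) = c * p x" if x: "x \<in> V" for c x
  proof (cases "0 \<le> c")
    case True
    then show ?thesis using sublinear_on_scale[OF p _ x] by simp
  next
    case False
    then have "p (- (c *\<^sub>R x)) = - c * p x"
      using sublinear_on_scale[OF p _ x, of "- c"] by simp
    then show ?thesis
      using odd[OF subspace_scale[OF V x]] by simp
  qed
qed

text \<open>Zorn's lemma applies because the pointwise infimum of a chain of sublinear functions
  below \<open>p\<close> is again one.\<close>

lemma ex_minimal_sublinear_on:
  assumes p: "sublinear_on V p"
  obtains f where "sublinear_on V f" "\<And>x. x \<in> V \<Longrightarrow> f x \<le> p x"
    "\<forall>q. sublinear_on V q \<longrightarrow> (\<forall>x\<in>V. q x \<le> f x) \<longrightarrow> (\<forall>x\<in>V. f x \<le> q x)"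
proof -
  \<comment> \<open>The order sees values on \<open>V\<close> only, so antisymmetry requires
    functions that are determined by these values, hence \<open>extensional V\<close>. The relation
    \<open>P\<close> reverses the pointwise order, so that a maximal element for \<open>P\<close> is
    a minimal functional.\<close>
  define B where "B = {q \<in> extensional V. sublinear_on V q \<and> (\<forall>x\<in>V. q x \<le> p x)}"
  define P where "P q r \<longleftrightarrow> (\<forall>x\<in>V. r x \<le> q x)" for q r :: "'v \<Rightarrow> real"
  have restr: "sublinear_on V (restrict q V)" if "sublinear_on V q" for q
    using that subspace_add[OF V] subspace_scale[OF V] by (auto simp: sublinear_on_def)
  have "\<exists>m\<in>B. \<forall>q\<in>B. P m q \<longrightarrow> q = m"
  proof (rule predicate_Zorn)
    show "partial_order_on B (relation_of P B)"
    proof (rule partial_order_on_relation_ofI)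
      fix q r assume "q \<in> B" "r \<in> B" "P q r" "P r q"
      then show "q = r"
        by (intro extensionalityI[of q V r]) (auto simp: B_def P_def intro: order_antisym)
    qed (auto simp: P_def intro: order_trans)
  next
    fix C assume "C \<in> Chains (relation_of P B)"
    then have CB: "C \<subseteq> B" and chain: "\<And>q r. q \<in> C \<Longrightarrow> r \<in> C \<Longrightarrow> P q r \<or> P r q"
      by (auto simp: Chains_def relation_of_def)
    show "\<exists>u\<in>B. \<forall>q\<in>C. P q u"
    proof (cases "C = {}")
      case True
      have "restrict p V \<in> B" using restr[OF p] by (auto simp: B_def)
      with True show ?thesis by auto
    next
      case False
      define u where "u x = (INF q\<in>C. q x)" for x
      have sub: "sublinear_on V q" if "q \<in> C" for q using that CB by (auto simp: B_def)
      have le_p: "q x \<le> p x" if "q \<in> C" "x \<in> V" for q x using that CB by (auto simp: B_def)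
      \<comment> \<open>Subadditivity bounds every member of the chain below by the same number, so
        the infimum \<open>u\<close> is meaningful.\<close>
      have "- p (- x) \<le> q x" if "q \<in> C" "x \<in> V" for q x
        using sublinear_on_uminus[OF sub that(2)] le_p[OF _ subspace_neg[OF V that(2)]] that
        by (smt (verit))
      then have bdd: "bdd_below ((\<lambda>q. q x) ` C)" if "x \<in> V" for x
        using that by (intro bdd_belowI2) auto
      have u_le: "u x \<le> q x" if "q \<in> C" "x \<in> V" for q x
        unfolding u_def using that by (intro cINF_lower bdd) auto
      have ge_u: "m \<le> u x" if "\<And>q. q \<in> C \<Longrightarrow> m \<le> q x" for m x
        unfolding u_def using False that by (intro cINF_greatest) auto
      have u: "sublinear_on V u"
      proof (rule sublinear_onI)
        fix x y assume xy: "x \<in> V" "y \<in> V"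
        have *: "u (x + y) \<le> q x + r y" if qr: "q \<in> C" "r \<in> C" for q r
        proof -
          \<comment> \<open>Here comparability is used: the smaller of \<open>q\<close> and
            \<open>r\<close> serves for both arguments. For an arbitrary family the infimum could
            fail to be subadditive.\<close>
          have "\<exists>s\<in>C. s x \<le> q x \<and> s y \<le> r y"
            using chain[OF qr] qr xy by (auto simp: P_def)
          then obtain s where s: "s \<in> C" "s x \<le> q x" "s y \<le> r y" by blast
          have "u (x + y) \<le> s (x + y)" using s xy by (intro u_le subspace_add[OF V])
          also have "\<dots> \<le> s x + s y" using sub[OF s(1)] xy by (simp add: sublinear_on_def)
          finally show ?thesis using s by simp
        qed
        have "u (x + y) - r y \<le> u x" if "r \<in> C" for r
          using *[OF _ that] by (intro ge_u) (simp add: algebra_simps)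
        then have "u (x + y) - u x \<le> u y"
          by (intro ge_u) (simp add: algebra_simps)
        then show "u (x + y) \<le> u x + u y" by simp
      next
        fix c :: real and x assume c: "0 \<le> c" and x: "x \<in> V"
        have *: "u (c *\<^sub>R x) \<le> c * q x" if "q \<in> C" for q
          using u_le[OF that subspace_scale[OF V x, of c]] sublinear_on_scale[OF sub[OF that] c x]
          by simp
        show "u (c *\<^sub>R x) \<le> c * u x"
        proof (cases "c = 0")
          case True
          then show ?thesis using * False by auto
        next
          case False
          then have "u (c *\<^sub>R x) / c \<le> u x"
            using * c by (intro ge_u) (simp add: field_simps)
          then show ?thesis using False c by (simp add: field_simps)
        qed
      qed
      have "u x \<le> p x" if "x \<in> V" for x
        using False u_le[OF _ that] le_p[OF _ that] by (meson ex_in_conv order_trans)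
      then have "restrict u V \<in> B" using restr[OF u] by (auto simp: B_def)
      moreover have "\<forall>q\<in>C. P q (restrict u V)" using u_le by (auto simp: P_def)
      ultimately show ?thesis by blast
    qed
  qed
  then obtain m where m: "m \<in> B" and min: "\<And>q. q \<in> B \<Longrightarrow> P m q \<Longrightarrow> q = m" by blast
  show ?thesis
  proof
    show "sublinear_on V m" "\<And>x. x \<in> V \<Longrightarrow> m x \<le> p x" using m by (auto simp: B_def)
    have "m x \<le> q x" if q: "sublinear_on V q" "\<forall>x\<in>V. q x \<le> m x" and x: "x \<in> V" for q x
    proof -
      have "restrict q V \<in> B"
        using restr[OF q(1)] q(2) m by (fastforce simp: B_def)
      then have "restrict q V = m" using q(2) by (intro min) (auto simp: P_def)
      then show ?thesis using x by (metis order_refl restrict_apply')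
    qed
    then show "\<forall>q. sublinear_on V q \<longrightarrow> (\<forall>x\<in>V. q x \<le> m x) \<longrightarrow> (\<forall>x\<in>V. m x \<le> q x)"
      by blast
  qed
qed

text \<open>A minimal functional below \<open>p\<close> lowered at \<open>y\<close> is linear, and
  the lowering fixes its value there: \<open>- f y = f (- y) \<le> - p y\<close> together with
  \<open>f y \<le> p y\<close>.\<close>

theorem hahn_banach_at:
  assumes p: "sublinear_on V p" and y: "y \<in> V"
  obtains f where "\<And>x z. x \<in> V \<Longrightarrow> z \<in> V \<Longrightarrow> f (x + z) = f x + f z"
    "\<And>c x. x \<in> V \<Longrightarrow> f (c *\<^sub>R x) = c * f x"
    "\<And>x. x \<in> V \<Longrightarrow> f x \<le> p x" "f y = p y"
proof -
  obtain q where q: "sublinear_on V q" "\<And>x. x \<in> V \<Longrightarrow> q x \<le> p x" "q (- y) \<le> - p y"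
    using sublinear_on_lower_at[OF p y] by blast
  obtain f where f: "sublinear_on V f" "\<And>x. x \<in> V \<Longrightarrow> f x \<le> q x"
    "\<forall>q. sublinear_on V q \<longrightarrow> (\<forall>x\<in>V. q x \<le> f x) \<longrightarrow> (\<forall>x\<in>V. f x \<le> q x)"
    using ex_minimal_sublinear_on[OF q(1)] by blast
  note lin = minimal_sublinear_on_linear[OF f(1) f(3)]
  show ?thesis
  proof
    show "f (x + z) = f x + f z" if "x \<in> V" "z \<in> V" for x z using lin(1) that by blast
    show scale: "f (c *\<^sub>R x) = c * f x" if "x \<in> V" for c x using lin(2) that by blast
    show le: "f x \<le> p x" if "x \<in> V" for x using f(2) q(2) that by (meson order_trans)
    have "f (- y) = - f y" using scale[OF y, of "- 1"] by simp
    moreover have "f (- y) \<le> - p y"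
      using f(2)[OF subspace_neg[OF V y]] q(3) by simp
    ultimately show "f y = p y" using le[OF y] by simp
  qed
qed

text \<open>The distance \<open>p\<close> from \<open>K\<close>, measured by \<open>n\<close>, is
  sublinear because \<open>K\<close> is a convex cone; it lies below \<open>n\<close> because
  \<open>0 \<in> K\<close>, vanishes on \<open>K\<close> and is at least \<open>e\<close> at
  \<open>y\<close>. A linear functional below \<open>p\<close> with value \<open>p y\<close> at
  \<open>y\<close> is therefore bounded by \<open>n\<close>, nonpositive on \<open>K\<close> and
  positive at \<open>y\<close>.\<close>

theorem separation_from_cone:
  assumes n: "sublinear_on V n" and n_nonneg: "\<And>x. x \<in> V \<Longrightarrow> 0 \<le> n x"
    and K: "K \<subseteq> V" "0 \<in> K" "\<And>k l. k \<in> K \<Longrightarrow> l \<in> K \<Longrightarrow> k + l \<in> K"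
      "\<And>c k. 0 < c \<Longrightarrow> k \<in> K \<Longrightarrow> c *\<^sub>R k \<in> K"
    and y: "y \<in> V" and e: "0 < e" "\<And>k. k \<in> K \<Longrightarrow> e \<le> n (y - k)"
  obtains f where "\<And>x z. x \<in> V \<Longrightarrow> z \<in> V \<Longrightarrow> f (x + z) = f x + f z"
    "\<And>c x. x \<in> V \<Longrightarrow> f (c *\<^sub>R x) = c * f x"
    "\<And>x. x \<in> V \<Longrightarrow> f x \<le> n x" "\<And>k. k \<in> K \<Longrightarrow> f k \<le> 0" "0 < f y"
proof -
  define p where "p x = (INF k\<in>K. n (x - k))" for x
  have diff: "x - k \<in> V" if "x \<in> V" "k \<in> K" for x k
    using that K(1) subspace_diff[OF V] by blast
  have p_le: "p x \<le> n (x - k)" if "x \<in> V" "k \<in> K" for x k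
    unfolding p_def using that n_nonneg[OF diff[OF that(1)]]
    by (intro cINF_lower bdd_belowI2[of _ 0]) auto
  have ge_p: "m \<le> p x" if "\<And>k. k \<in> K \<Longrightarrow> m \<le> n (x - k)" for m x
    unfolding p_def using K(2) that by (intro cINF_greatest) auto
  have "sublinear_on V p"
  proof (rule sublinear_onI)
    fix x z assume xz: "x \<in> V" "z \<in> V"
    have *: "p (x + z) \<le> n (x - k) + n (z - l)" if kl: "k \<in> K" "l \<in> K" for k l
    proof -
      have "p (x + z) \<le> n (x + z - (k + l))" using xz kl by (intro p_le subspace_add[OF V] K)
      also have "x + z - (k + l) = (x - k) + (z - l)" by simp
      also have "n \<dots> \<le> n (x - k) + n (z - l)"
        using n diff xz kl unfolding sublinear_on_def by blast
      finally show ?thesis .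
    qed
    have "p (x + z) - n (z - l) \<le> p x" if "l \<in> K" for l
      using *[OF _ that] by (intro ge_p) (simp add: algebra_simps)
    then have "p (x + z) - p x \<le> p z"
      by (intro ge_p) (simp add: algebra_simps)
    then show "p (x + z) \<le> p x + p z" by simp
  next
    fix c :: real and x assume c: "0 \<le> c" and x: "x \<in> V"
    show "p (c *\<^sub>R x) \<le> c * p x"
    proof (cases "c = 0")
      case True
      then show ?thesis using p_le[OF subspace_0[OF V] K(2)] sublinear_on_0[OF n] by simp
    next
      case False
      have "p (c *\<^sub>R x) / c \<le> p x"
      proof (rule ge_p)
        fix k assume k: "k \<in> K"
        have "p (c *\<^sub>R x) \<le> n (c *\<^sub>R x - c *\<^sub>R k)"
          using x k c False by (intro p_le subspace_scale[OF V] K) auto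
        also have "\<dots> = c * n (x - k)"
          using sublinear_on_scale[OF n c diff[OF x k]] by (simp add: algebra_simps)
        finally show "p (c *\<^sub>R x) / c \<le> n (x - k)" using c False by (simp add: field_simps)
      qed
      then show ?thesis using c False by (simp add: field_simps)
    qed
  qed
  then obtain f where f: "\<And>x z. x \<in> V \<Longrightarrow> z \<in> V \<Longrightarrow> f (x + z) = f x + f z"
      "\<And>c x. x \<in> V \<Longrightarrow> f (c *\<^sub>R x) = c * f x" "\<And>x. x \<in> V \<Longrightarrow> f x \<le> p x" "f y = p y"
    using hahn_banach_at y by blast
  show ?thesis
  proof
    show "f x \<le> n x" if "x \<in> V" for x
      using f(3)[OF that] p_le[OF that K(2)] by simp
    show "f k \<le> 0" if "k \<in> K" for k
      using f(3)[of k] p_le[of k k] that K(1) sublinear_on_0[OF n] by force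
    show "0 < f y" using f(4) ge_p[of e y] e by simp
  qed (use f in blast)+
qed

end

text \<open>Together with the pointwise operations of \<open>Function_Algebras\<close> this makes
  claims elements of a real vector space, as \<open>separation_from_cone\<close> requires.\<close>

instantiation "fun" :: (type, real_vector) real_vector
begin

definition scaleR_fun :: "real \<Rightarrow> ('a \<Rightarrow> 'b) \<Rightarrow> 'a \<Rightarrow> 'b" where
  "c *\<^sub>R f = (\<lambda>x. c *\<^sub>R f x)"

instance
  by standard (simp_all add: scaleR_fun_def fun_eq_iff scaleR_add_right scaleR_add_left)

end

section \<open>Bounded densities\<close>

text \<open>On indicators \<open>f\<close> defines a measure \<open>\<nu>\<close>: countable
  additivity comes from the L1 bound through dominated convergence, and the same bound gives
  \<open>\<nu> \<le> M\<close>, hence a Radon-Nikodym density that is at most 1 almost everywhere.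
  Agreement on indicators extends to integrable functions by approximation.\<close>

lemma (in finite_measure) L1_dominated_functional_density:
  fixes f :: "('a \<Rightarrow> real) \<Rightarrow> real"
  assumes add: "\<And>X Y. integrable M X \<Longrightarrow> integrable M Y \<Longrightarrow> f (\<lambda>\<omega>. X \<omega> + Y \<omega>) = f X + f Y"
    and scale: "\<And>c X. integrable M X \<Longrightarrow> f (\<lambda>\<omega>. c * X \<omega>) = c * f X"
    and bound: "\<And>X. integrable M X \<Longrightarrow> f X \<le> (\<integral>\<omega>. \<bar>X \<omega>\<bar> \<partial>M)"
    and nonneg: "\<And>X. integrable M X \<Longrightarrow> (\<And>\<omega>. 0 \<le> X \<omega>) \<Longrightarrow> 0 \<le> f X"
  obtains D where "D \<in> borel_measurable M" "\<And>\<omega>. 0 \<le> D \<omega>" "\<And>\<omega>. D \<omega> \<le> 1"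
    "\<And>X. integrable M X \<Longrightarrow> f X = (\<integral>\<omega>. D \<omega> * X \<omega> \<partial>M)"
proof -
  have diff: "f (\<lambda>\<omega>. X \<omega> - Y \<omega>) = f X - f Y" if "integrable M X" "integrable M Y" for X Y
    using add[of X "\<lambda>\<omega>. (- 1) * Y \<omega>"] scale[of Y "- 1"] that by simp
  have bound': "\<bar>f X\<bar> \<le> (\<integral>\<omega>. \<bar>X \<omega>\<bar> \<partial>M)" if "integrable M X" for X
    using bound[OF that] bound[of "\<lambda>\<omega>. (- 1) * X \<omega>"] scale[OF that, of "- 1"] that by simp
  \<comment> \<open>Since \<open>f\<close> is Lipschitz for the L1 seminorm, it respects dominated
    limits. This serves for countable additivity of \<open>\<nu>\<close> and for the limit case of
    the final induction.\<close>
  have dominated: "(\<lambda>n. f (s n)) \<longlonglongrightarrow> f X"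
    if s: "\<And>n. integrable M (s n)" and X: "integrable M X" and w: "integrable M w"
      and ptw: "\<And>\<omega>. \<omega> \<in> space M \<Longrightarrow> (\<lambda>n. s n \<omega>) \<longlonglongrightarrow> X \<omega>"
      and dom: "\<And>n \<omega>. \<omega> \<in> space M \<Longrightarrow> \<bar>s n \<omega>\<bar> \<le> w \<omega>" for s X w
  proof -
    have "(\<lambda>n. \<integral>\<omega>. \<bar>s n \<omega> - X \<omega>\<bar> \<partial>M) \<longlonglongrightarrow> (\<integral>\<omega>. 0 \<partial>M)"
    proof (rule integral_dominated_convergence[where w = "\<lambda>\<omega>. w \<omega> + \<bar>X \<omega>\<bar>"])
      show "AE \<omega> in M. (\<lambda>n. \<bar>s n \<omega> - X \<omega>\<bar>) \<longlonglongrightarrow> 0"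
        using ptw by (intro AE_I2 tendsto_rabs_zero) (simp add: LIM_zero_iff)
      show "AE \<omega> in M. norm \<bar>s n \<omega> - X \<omega>\<bar> \<le> w \<omega> + \<bar>X \<omega>\<bar>" for n
        using dom[of _ n] by (intro AE_I2) force
    qed (use s X w in auto)
    then have "(\<lambda>n. \<integral>\<omega>. \<bar>s n \<omega> - X \<omega>\<bar> \<partial>M) \<longlonglongrightarrow> 0"
      by simp
    then have "(\<lambda>n. f (s n) - f X) \<longlonglongrightarrow> 0"
    proof (rule Lim_null_comparison[rotated])
      show "\<forall>\<^sub>F n in sequentially. norm (f (s n) - f X) \<le> (\<integral>\<omega>. \<bar>s n \<omega> - X \<omega>\<bar> \<partial>M)"
        using bound'[of "\<lambda>\<omega>. s n \<omega> - X \<omega>" for n] s X by (intro always_eventually) (simp add: diff)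
    qed
    then show ?thesis by (simp add: LIM_zero_iff)
  qed
  have ind: "integrable M (indicator A :: 'a \<Rightarrow> real)" if "A \<in> sets M" for A
    using that by (simp add: emeasure_eq_measure)
  define \<nu> where "\<nu> = measure_of (space M) (sets M) (\<lambda>A. ennreal (f (indicator A)))"
  have sets_\<nu> [simp, measurable_cong]: "sets \<nu> = sets M" by (simp add: \<nu>_def)
  have "(\<lambda>\<omega>. 0 * indicator {} \<omega>) = (indicator {} :: 'a \<Rightarrow> real)" by auto
  then have zero: "f (indicator {}) = 0"
    using scale[OF ind[OF sets.empty_sets], of 0] by simp
  have emeasure_\<nu>: "emeasure \<nu> A = ennreal (f (indicator A))" if "A \<in> sets M" for A
  proof (rule emeasure_measure_of[OF \<nu>_def])
    show "sets M \<subseteq> Pow (space M)" by (rule sets.space_closed)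
    show "A \<in> sets \<nu>" using that by simp
    show "positive (sets \<nu>) (\<lambda>A. ennreal (f (indicator A)))"
      using zero by (simp add: positive_def)
    show "countably_additive (sets \<nu>) (\<lambda>A. ennreal (f (indicator A)))"
    proof (rule countably_additiveI)
      fix B :: "nat \<Rightarrow> 'a set"
      assume "range B \<subseteq> sets \<nu>" and disj: "disjoint_family B"
      then have B: "B i \<in> sets M" for i by auto
      have part: "f (indicator (\<Union>i<n. B i)) = (\<Sum>i<n. f (indicator (B i)))" for n
      proof (induction n)
        case (Suc n)
        have "B n \<inter> B i = {}" if "i < n" for i
          using that by (intro disjoint_family_onD[OF disj]) auto
        then have "(indicator (\<Union>i<Suc n. B i) :: 'a \<Rightarrow> real) =
            (\<lambda>\<omega>. indicator (\<Union>i<n. B i) \<omega> + indicator (B n) \<omega>)"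
          by (simp add: fun_eq_iff lessThan_Suc indicator_def) blast
        then show ?case using Suc B by (simp add: add ind)
      qed (use zero in \<open>simp add: indicator_def[abs_def]\<close>)
      have "(\<lambda>n. f (indicator (\<Union>i<n. B i))) \<longlonglongrightarrow> f (indicator (\<Union>i. B i))"
        using B by (intro dominated[where w = "\<lambda>_. 1"] ind LIMSEQ_indicator_UN)
          (auto simp: indicator_def)
      then have "(\<lambda>i. f (indicator (B i))) sums f (indicator (\<Union>i. B i))"
        by (simp add: sums_def part)
      then show "(\<Sum>i. ennreal (f (indicator (B i)))) = ennreal (f (indicator (\<Union>i. B i)))"
        using B by (intro suminf_ennreal_eq nonneg ind) auto
    qed
  qed
  have \<nu>_le: "emeasure \<nu> A \<le> emeasure M A" if "A \<in> sets M" for A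
    using bound[OF ind[OF that]] that by (simp add: emeasure_\<nu> emeasure_eq_measure)
  have "finite_measure \<nu>"
    using \<nu>_le[OF sets.top] by (intro finite_measureI)
      (auto simp: sets_eq_imp_space_eq[OF sets_\<nu>] top_unique)
  moreover have "absolutely_continuous M \<nu>"
    using \<nu>_le by (auto simp: absolutely_continuous_def null_sets_def) (metis le_zero_eq)
  ultimately obtain g where g [measurable]: "g \<in> borel_measurable M" and \<nu>: "density M g = \<nu>"
    using Radon_Nikodym_finite_measure[OF _ sets_\<nu>] by blast
  \<comment> \<open>The excess of \<open>g\<close> over 1 has integral
    \<open>\<nu> ?A - M ?A\<close> over the set \<open>?A\<close> where \<open>g\<close> exceeds 1;
    as subtraction in \<open>ennreal\<close> is truncated, \<open>\<nu> \<le> M\<close> makes this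
    0.\<close>
  have "AE \<omega> in M. (g \<omega> - 1) * indicator {\<omega> \<in> space M. 1 < g \<omega>} \<omega> = 0"
  proof -
    let ?A = "{\<omega> \<in> space M. 1 < g \<omega>}"
    have "(\<integral>\<^sup>+\<omega>. (g \<omega> - 1) * indicator ?A \<omega> \<partial>M)
        = (\<integral>\<^sup>+\<omega>. g \<omega> * indicator ?A \<omega> - indicator ?A \<omega> \<partial>M)"
      by (intro nn_integral_cong) (auto simp: indicator_def)
    also have "\<dots> = (\<integral>\<^sup>+\<omega>. g \<omega> * indicator ?A \<omega> \<partial>M) - (\<integral>\<^sup>+\<omega>. indicator ?A \<omega> \<partial>M)"
      by (intro nn_integral_diff AE_I2)
        (auto simp: emeasure_eq_measure less_imp_le split: split_indicator)
    also have "\<dots> = emeasure \<nu> ?A - emeasure M ?A"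
      by (simp add: \<nu>[symmetric] emeasure_density)
    also have "\<dots> = 0"
      using \<nu>_le[of ?A]
      by (intro diff_eq_0_ennreal) (auto simp: emeasure_eq_measure intro: le_less_trans)
    finally show ?thesis by (subst (asm) nn_integral_0_iff_AE) auto
  qed
  then have g_le: "AE \<omega> in M. g \<omega> \<le> 1"
    using AE_space
    by eventually_elim (auto simp: indicator_def diff_eq_0_iff_ennreal split: if_splits)
  \<comment> \<open>The truncation changes \<open>g\<close> on a null set only. It makes the bound
    by 1 hold everywhere and keeps \<open>enn2real\<close> away from infinity, which it would send
    to 0.\<close>
  define D where "D \<omega> = enn2real (min 1 (g \<omega>))" for \<omega>
  have D_meas [measurable]: "D \<in> borel_measurable M"
    unfolding D_def[abs_def] by measurable
  have D: "0 \<le> D \<omega>" "D \<omega> \<le> 1" for \<omega>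
    by (auto simp: D_def intro: enn2real_leI)
  have D_int: "integrable M (\<lambda>\<omega>. D \<omega> * X \<omega>)" if "integrable M X" for X
  proof (rule Bochner_Integration.integrable_bound[OF that])
    show "AE \<omega> in M. norm (D \<omega> * X \<omega>) \<le> norm (X \<omega>)"
      using D by (auto simp: abs_mult intro!: mult_left_le_one_le)
  qed (use that in measurable)
  have f_ind: "f (indicator A) = (\<integral>\<omega>. D \<omega> * indicator A \<omega> \<partial>M)" if A: "A \<in> sets M" for A
  proof -
    have "ennreal (f (indicator A)) = (\<integral>\<^sup>+\<omega>. g \<omega> * indicator A \<omega> \<partial>M)"
      using A by (simp add: emeasure_\<nu>[symmetric] \<nu>[symmetric] emeasure_density)
    also have "\<dots> = (\<integral>\<^sup>+\<omega>. ennreal (D \<omega> * indicator A \<omega>) \<partial>M)"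
      using g_le by (intro nn_integral_cong_AE, eventually_elim)
        (auto simp: D_def indicator_def min_absorb2 ennreal_enn2real_if top_unique)
    also have "\<dots> = ennreal (\<integral>\<omega>. D \<omega> * indicator A \<omega> \<partial>M)"
      using D(1) by (intro nn_integral_eq_integral D_int ind A) auto
    finally show ?thesis
      using nonneg[OF ind[OF A]] D(1) by (simp add: integral_nonneg_AE)
  qed
  have "f X = (\<integral>\<omega>. D \<omega> * X \<omega> \<partial>M)" if "integrable M X" for X
    using that
  proof (induction rule: integrable_induct)
    case (base A c)
    then show ?case
      using scale[OF ind, of A c] f_ind[of A] by (simp add: mult.commute mult.left_commute)
  next
    case (add X Y)
    then show ?case
      using D_int by (simp add: assms(1) distrib_left)
  next
    case (lim X s)
    have "(\<lambda>n. f (s n)) \<longlonglongrightarrow> f X"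
      \<comment> \<open>The factor 2 is the domination that \<open>integrable_induct\<close>
        provides for its approximating sequence.\<close>
      using lim by (intro dominated[where w = "\<lambda>\<omega>. 2 * \<bar>X \<omega>\<bar>"]) auto
    moreover have "(\<lambda>n. \<integral>\<omega>. D \<omega> * s n \<omega> \<partial>M) \<longlonglongrightarrow> (\<integral>\<omega>. D \<omega> * X \<omega> \<partial>M)"
    proof (rule integral_dominated_convergence[where w = "\<lambda>\<omega>. 2 * \<bar>X \<omega>\<bar>"])
      show "AE \<omega> in M. (\<lambda>n. D \<omega> * s n \<omega>) \<longlonglongrightarrow> D \<omega> * X \<omega>"
        using lim by (intro AE_I2 tendsto_mult_left) auto
      show "AE \<omega> in M. norm (D \<omega> * s n \<omega>) \<le> 2 * \<bar>X \<omega>\<bar>" for n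
        using lim.hyps(3) D
        by (intro AE_I2) (auto simp: abs_mult intro!: order_trans[OF mult_left_le_one_le])
    qed (use lim in auto)
    ultimately show ?case
      using lim.IH by (simp add: LIMSEQ_unique)
  qed
  with D_meas D that show ?thesis by blast
qed

section \<open>Exhaustion: from many partial supports to full support\<close>

text \<open>The support of a combination with positive weights is the union of the supports, so
  combining a maximizing sequence attains the supremum of \<open>m\<close>. If the set
  \<open>A\<close> where the result \<open>D\<close> vanishes had positive measure,
  \<open>ex\<close> would give an element charging \<open>A\<close>, and combining it with
  \<open>D\<close> would enlarge the support.\<close>

lemma (in finite_measure) ex_AE_positive_element:
  fixes \<D> :: "('a \<Rightarrow> real) set"
  assumes ne: "\<D> \<noteq> {}"
    and meas: "\<And>D. D \<in> \<D> \<Longrightarrow> D \<in> borel_measurable M"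
    and range: "\<And>D \<omega>. D \<in> \<D> \<Longrightarrow> 0 \<le> D \<omega> \<and> D \<omega> \<le> 1"
    and mix: "\<And>Ds. (\<And>n. Ds n \<in> \<D>) \<Longrightarrow> (\<lambda>\<omega>. \<Sum>n. (1/2) ^ Suc n * Ds n \<omega>) \<in> \<D>"
    and ex: "\<And>A. A \<in> sets M \<Longrightarrow> 0 < measure M A \<Longrightarrow>
               \<exists>D\<in>\<D>. 0 < (\<integral>\<omega>. D \<omega> * indicator A \<omega> \<partial>M)"
  obtains D where "D \<in> \<D>" "AE \<omega> in M. 0 < D \<omega>"
proof -
  define m where "m D = measure M {\<omega> \<in> space M. 0 < D \<omega>}" for D :: "'a \<Rightarrow> real"
  have pos_iff: "0 < (\<Sum>n. (1/2) ^ Suc n * Ds n \<omega>) \<longleftrightarrow> (\<exists>n. 0 < Ds n \<omega>)"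
    if "\<And>n. Ds n \<in> \<D>" for Ds :: "nat \<Rightarrow> 'a \<Rightarrow> real" and \<omega>
  proof -
    have "summable (\<lambda>n. (1/2) ^ Suc n * Ds n \<omega>)"
      by (rule summable_comparison_test'[OF sums_summable[OF power_half_series]])
        (use range[OF that] in \<open>auto simp: abs_mult power_one_over divide_right_mono\<close>)
    then show ?thesis
      using range[OF that] by (subst suminf_pos_iff) (auto simp: zero_less_mult_iff)
  qed
  have bdd: "bdd_above (m ` \<D>)"
    by (auto simp: m_def intro!: bdd_aboveI2[of _ _ "measure M (space M)"] bounded_measure)
  have "\<exists>D\<in>\<D>. (SUP D\<in>\<D>. m D) - inverse (real (Suc n)) < m D" for n
    using less_cSUP_iff[OF ne bdd, of "(SUP D\<in>\<D>. m D) - inverse (real (Suc n))"] by simp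
  then obtain Ds where Ds: "\<And>n. Ds n \<in> \<D>"
    and Ds_m: "\<And>n. (SUP D\<in>\<D>. m D) - inverse (real (Suc n)) < m (Ds n)" by metis
  define D where "D = (\<lambda>\<omega>. \<Sum>n. (1/2) ^ Suc n * Ds n \<omega>)"
  have D: "D \<in> \<D>" unfolding D_def by (rule mix[OF Ds])
  note [measurable] = meas[OF D]
  have "m (Ds n) \<le> m D" for n
    unfolding m_def
  proof (rule finite_measure_mono)
    show "{\<omega> \<in> space M. 0 < Ds n \<omega>} \<subseteq> {\<omega> \<in> space M. 0 < D \<omega>}"
      unfolding D_def using pos_iff[OF Ds] by auto
  qed measurable
  then have "(SUP D\<in>\<D>. m D) - m D \<le> inverse (real (Suc n))" for n
    using Ds_m[of n] by (smt (verit))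
  then have "(SUP D\<in>\<D>. m D) - m D \<le> 0"
    by (intro LIMSEQ_le_const[OF LIMSEQ_inverse_real_of_nat]) auto
  then have max: "m D' \<le> m D" if "D' \<in> \<D>" for D'
    using cSUP_upper[OF that bdd] by simp
  define A where "A = {\<omega> \<in> space M. \<not> 0 < D \<omega>}"
  have A [measurable]: "A \<in> sets M" unfolding A_def by measurable
  have "measure M A = 0"
  proof (rule ccontr)
    assume "measure M A \<noteq> 0"
    then obtain E where E: "E \<in> \<D>" and int: "0 < (\<integral>\<omega>. E \<omega> * indicator A \<omega> \<partial>M)"
      using ex[OF A] by (metis measure_nonneg order_le_less)
    note [measurable] = meas[OF E]
    \<comment> \<open>The countable operation also combines two elements: \<open>D\<close> receives
      weight 1/2 and the constant tail \<open>E\<close> the remaining 1/2.\<close>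
    define Es where "Es n = (if n = 0 then D else E)" for n :: nat
    define G where "G = (\<lambda>\<omega>. \<Sum>n. (1/2) ^ Suc n * Es n \<omega>)"
    have Es: "Es n \<in> \<D>" for n using D E by (simp add: Es_def)
    have G: "G \<in> \<D>" unfolding G_def by (rule mix[OF Es])
    have G_pos: "0 < G \<omega> \<longleftrightarrow> 0 < D \<omega> \<or> 0 < E \<omega>" for \<omega>
      unfolding G_def pos_iff[OF Es] by (auto simp: Es_def intro: exI[of _ 0] exI[of _ 1])
    let ?B = "{\<omega> \<in> space M. 0 < E \<omega>} \<inter> A"
    have "m G = m D + measure M ?B"
      unfolding m_def by (subst finite_measure_Union[symmetric])
        (auto simp: A_def G_pos intro!: arg_cong[where f = "measure M"])
    moreover have "measure M ?B \<noteq> 0"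
    proof
      assume "measure M ?B = 0"
      then have "AE \<omega> in M. \<omega> \<notin> ?B"
        by (intro AE_not_in) (simp add: null_sets_def emeasure_eq_measure)
      then have "AE \<omega> in M. E \<omega> * indicator A \<omega> = 0"
        using AE_space by eventually_elim (use range[OF E] in \<open>auto simp: indicator_def order_le_less\<close>)
      then have "(\<integral>\<omega>. E \<omega> * indicator A \<omega> \<partial>M) = 0"
        by (rule integral_eq_zero_AE)
      with int show False by simp
    qed
    ultimately show False
      using max[OF G] measure_nonneg[of M ?B] by simp
  qed
  then have "AE \<omega> in M. \<omega> \<notin> A"
    by (intro AE_not_in) (simp add: null_sets_def emeasure_eq_measure)
  then have "AE \<omega> in M. 0 < D \<omega>"
    using AE_space by eventually_elim (simp add: A_def)
  with D that show ?thesis by blast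
qed

section \<open>Mixtures\<close>

text \<open>\<open>subprob_algebra\<close> carries the smallest \<sigma>-field that makes
  evaluations measurable, so the identity is a kernel whatever admissible \<sigma>-field \<mu> lives
  on.\<close>

lemma measurable_second_order_prior:
  assumes "second_order_prior M \<mu>"
  shows "(\<lambda>P. P) \<in> measurable \<mu> (subprob_algebra M)"
proof (rule measurable_subprob_algebra)
  have prob: "prob_space P \<and> sets P = sets M" if "P \<in> space \<mu>" for P
    using that assms by (auto simp: second_order_prior_def space_prob_algebra)
  then show "subprob_space P" "sets P = sets M" if "P \<in> space \<mu>" for P
    using that by (auto intro: prob_space_imp_subprob_space)
  fix A assume "A \<in> sets M"
  then have "(\<lambda>P. ennreal (measure P A)) \<in> borel_measurable \<mu>"
    using assms by (auto simp: second_order_prior_def)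
  also have "?this \<longleftrightarrow> (\<lambda>P. emeasure P A) \<in> borel_measurable \<mu>"
    using prob by (intro measurable_cong)
      (metis finite_measure.emeasure_eq_measure prob_space.finite_measure)
  finally show "(\<lambda>P. emeasure P A) \<in> borel_measurable \<mu>" .
qed

text \<open>Gives access to the Giry monad results on iterated integrals and null sets,
  \<open>nn_integral_bind\<close> and \<open>AE_bind\<close>.\<close>

lemma mixture_eq_bind:
  assumes "second_order_prior M \<mu>"
  shows "mixture M \<mu> = \<mu> \<bind> (\<lambda>P. P)"
proof -
  have ne: "space \<mu> \<noteq> {}"
    using assms by (auto simp: second_order_prior_def dest: prob_space.not_empty)
  have sets: "sets (\<mu> \<bind> (\<lambda>P. P)) = sets M"
    using ne sets_kernel[OF measurable_second_order_prior[OF assms]] by (intro sets_bind) auto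
  show ?thesis
    using ne measurable_second_order_prior[OF assms]
    by (intro measure_eqI) (simp_all add: sets emeasure_mixture[OF assms] emeasure_bind)
qed

lemma nn_integral_mixture:
  assumes "second_order_prior M \<mu>" "f \<in> borel_measurable M"
  shows "(\<integral>\<^sup>+\<omega>. f \<omega> \<partial>mixture M \<mu>) = (\<integral>\<^sup>+P. \<integral>\<^sup>+\<omega>. f \<omega> \<partial>P \<partial>\<mu>)"
  unfolding mixture_eq_bind[OF assms(1)]
  by (rule nn_integral_bind[OF assms(2) measurable_second_order_prior[OF assms(1)]])

lemma prob_space_mixture:
  assumes "second_order_prior M \<mu>"
  shows "prob_space (mixture M \<mu>)"
proof
  have "emeasure P (space M) = 1" if "P \<in> space \<mu>" for P
  proof -
    have "prob_space P" "sets P = sets M"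
      using that assms by (auto simp: second_order_prior_def space_prob_algebra)
    then show ?thesis by (metis prob_space.emeasure_space_1 sets_eq_imp_space_eq)
  qed
  then have "(\<integral>\<^sup>+P. emeasure P (space M) \<partial>\<mu>) = (\<integral>\<^sup>+P. 1 \<partial>\<mu>)"
    by (rule nn_integral_cong)
  also have "\<dots> = 1"
    using prob_space.emeasure_space_1[of \<mu>] assms by (simp add: second_order_prior_def)
  finally show "emeasure (mixture M \<mu>) (space (mixture M \<mu>)) = 1"
    using emeasure_mixture[OF assms sets.top] by simp
qed

text \<open>A set is null for the mixture iff it is null under \<mu>-almost every model
  \<open>P\<close>. This replaces the nested quantification over models by the null sets of a single
  measure.\<close>

lemma AE_mixture_iff:
  assumes prior: "second_order_prior M \<mu>" and [measurable]: "Measurable.pred M p"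
  shows "(AE \<omega> in mixture M \<mu>. p \<omega>) \<longleftrightarrow> (AE P in \<mu>. measure P {\<omega> \<in> space M. p \<omega>} = 1)"
proof -
  have "(AE \<omega> in mixture M \<mu>. p \<omega>) \<longleftrightarrow> (AE P in \<mu>. AE \<omega> in P. p \<omega>)"
    unfolding mixture_eq_bind[OF prior]
    by (rule AE_bind[OF measurable_second_order_prior[OF prior]]) measurable
  also have "\<dots> \<longleftrightarrow> (AE P in \<mu>. measure P {\<omega> \<in> space M. p \<omega>} = 1)"
  proof (intro eventually_subst AE_I2)
    fix P assume "P \<in> space \<mu>"
    then have "prob_space P" and [measurable_cong]: "sets P = sets M"
      using prior by (auto simp: second_order_prior_def space_prob_algebra)
    then interpret prob_space P by simp
    have "{\<omega> \<in> space P. p \<omega>} \<in> sets P" by measurable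
    then show "(AE \<omega> in P. p \<omega>) = (measure P {\<omega> \<in> space M. p \<omega>} = 1)"
      using prob_Collect_eq_1[of p] sets_eq_imp_space_eq[OF \<open>sets P = sets M\<close>] by simp
  qed
  finally show ?thesis .
qed

lemma prior_le_iff_AE:
  assumes prior: "second_order_prior M \<mu>"
    and [measurable]: "X \<in> borel_measurable M" "Y \<in> borel_measurable M"
  shows "prior_le M \<mu> X Y \<longleftrightarrow> (AE \<omega> in mixture M \<mu>. X \<omega> \<le> Y \<omega>)"
proof -
  interpret prob_space \<mu> using prior by (simp add: second_order_prior_def)
  have "{\<omega> \<in> space M. X \<omega> \<le> Y \<omega>} \<in> sets M" by measurable
  then have [measurable]: "(\<lambda>P. measure P {\<omega> \<in> space M. X \<omega> \<le> Y \<omega>}) \<in> borel_measurable \<mu>"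
    using prior by (simp add: second_order_prior_def)
  show ?thesis
    unfolding prior_le_def by (subst AE_mixture_iff[OF prior]) (measurable, simp add: prob_Collect_eq_1)
qed

text \<open>Under each \<open>P\<close> the events \<open>R > 0\<close> and \<open>R \<le> 0\<close>
  are complementary. Relevance thus becomes the strict part of \<open>prior_le\<close> above 0, the
  form in which \<open>martingale_measure\<close> states strict positivity.\<close>

lemma relevant_claims_eq:
  assumes prior: "second_order_prior M \<mu>"
  shows "relevant_claims M \<mu> =
    {R \<in> L1_space (mixture M \<mu>). prior_le M \<mu> (\<lambda>_. 0) R \<and> \<not> prior_le M \<mu> R (\<lambda>_. 0)}"
proof -
  interpret prob_space \<mu> using prior by (simp add: second_order_prior_def)
  have "measure \<mu> {P \<in> space \<mu>. measure P {\<omega> \<in> space M. R \<omega> > 0} > 0} > 0 \<longleftrightarrow>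
      \<not> prior_le M \<mu> R (\<lambda>_. 0)" if R: "R \<in> L1_space (mixture M \<mu>)" for R
  proof -
    have [measurable]: "R \<in> borel_measurable M"
      using R by (auto simp: L1_space_def dest: borel_measurable_integrable)
    let ?A = "{\<omega> \<in> space M. R \<omega> > 0}" and ?B = "{\<omega> \<in> space M. R \<omega> \<le> 0}"
    have [measurable]: "(\<lambda>P. measure P ?A) \<in> borel_measurable \<mu>"
      using prior by (auto simp: second_order_prior_def)
    have eq: "measure P ?B = 1 \<longleftrightarrow> \<not> measure P ?A > 0" if "P \<in> space \<mu>" for P
    proof -
      have "prob_space P" and [measurable_cong]: "sets P = sets M"
        using that prior by (auto simp: second_order_prior_def space_prob_algebra)
      then interpret P: prob_space P by simp
      have "?B = space P - ?A" "?A \<in> sets P"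
        using sets_eq_imp_space_eq[OF \<open>sets P = sets M\<close>] by auto
      then show ?thesis using P.prob_compl[of ?A] by (auto simp: zero_less_measure_iff)
    qed
    have "\<not> measure \<mu> {P \<in> space \<mu>. measure P ?A > 0} > 0 \<longleftrightarrow>
        (AE P in \<mu>. \<not> measure P ?A > 0)"
      using prob_Collect_eq_0[of "\<lambda>P. measure P ?A > 0"] by (simp add: zero_less_measure_iff)
    also have "\<dots> \<longleftrightarrow> (AE P in \<mu>. measure P ?B = 1)"
      using eq by (intro eventually_subst AE_I2) auto
    also have "\<dots> \<longleftrightarrow> prior_le M \<mu> R (\<lambda>_. 0)"
      by (subst AE_mixture_iff[OF prior, symmetric]) (auto simp: prior_le_iff_AE[OF prior])
    finally show ?thesis by blast
  qed
  then show ?thesis by (auto simp: relevant_claims_def)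
qed

section \<open>The topology of convergence in mean\<close>

lemma limitin_L1_topology:
  assumes "X \<in> L1_space N" "range Xs \<subseteq> L1_space N"
    and lim: "(\<lambda>n. \<integral>\<omega>. \<bar>Xs n \<omega> - X \<omega>\<bar> \<partial>N) \<longlonglongrightarrow> 0"
  shows "limitin (L1_topology N) Xs X sequentially"
  unfolding limitin_def
proof (intro conjI allI impI)
  fix U assume U: "openin (L1_topology N) U \<and> X \<in> U"
  then obtain e where e: "e > 0" "\<And>Y. Y \<in> L1_space N \<Longrightarrow> (\<integral>\<omega>. \<bar>Y \<omega> - X \<omega>\<bar> \<partial>N) < e \<Longrightarrow> Y \<in> U"
    unfolding openin_L1_topology by meson
  from order_tendstoD(2)[OF lim e(1)] show "\<forall>\<^sub>F n in sequentially. Xs n \<in> U"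
    by eventually_elim (use assms(2) e(2) in auto)
qed (use assms in simp)

lemma continuous_map_L1_topology:
  assumes lip: "\<And>X Y. X \<in> L1_space N \<Longrightarrow> Y \<in> L1_space N \<Longrightarrow>
      \<bar>f Y - f X\<bar> \<le> C * (\<integral>\<omega>. \<bar>Y \<omega> - X \<omega>\<bar> \<partial>N)"
    and C: "0 < C"
  shows "continuous_map (L1_topology N) euclideanreal f"
  unfolding continuous_map_def
proof (intro conjI allI impI)
  fix U assume "openin euclideanreal U"
  then have U: "open U" by simp
  show "openin (L1_topology N) {X \<in> topspace (L1_topology N). f X \<in> U}"
    unfolding openin_L1_topology
  proof (intro conjI ballI)
    fix X assume X: "X \<in> {X \<in> topspace (L1_topology N). f X \<in> U}"
    then obtain e where e: "e > 0" "\<And>y. dist y (f X) < e \<Longrightarrow> y \<in> U"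
      using U by (auto simp: open_dist)
    show "\<exists>\<epsilon>>0. \<forall>Y\<in>L1_space N. (\<integral>\<omega>. \<bar>Y \<omega> - X \<omega>\<bar> \<partial>N) < \<epsilon> \<longrightarrow>
        Y \<in> {X \<in> topspace (L1_topology N). f X \<in> U}"
    proof (intro exI[of _ "e / C"] conjI ballI impI)
      fix Y assume Y: "Y \<in> L1_space N" "(\<integral>\<omega>. \<bar>Y \<omega> - X \<omega>\<bar> \<partial>N) < e / C"
      then have "\<bar>f Y - f X\<bar> < e"
        using lip[of X Y] X C by (simp add: field_simps)
      then show "Y \<in> {X \<in> topspace (L1_topology N). f X \<in> U}"
        using Y e(2)[of "f Y"] by (simp add: dist_real_def)
    qed (use e C in simp)
  qed auto
qed auto

section \<open>Viability and martingale measures\<close>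

text \<open>Lower semi-continuity of the expectation agent comes from \<tau>-continuity of the
  functional, convexity from its linearity, and strict preference for relevant claims from its
  strict positivity.\<close>

lemma martingale_measure_imp_viable:
  assumes prior: "second_order_prior M \<mu>"
    and Q: "martingale_measure M (L1_space (mixture M \<mu>)) (L1_topology (mixture M \<mu>))
      (prior_le M \<mu>) I Q"
  shows "viable (L1_space (mixture M \<mu>)) (L1_topology (mixture M \<mu>)) (prior_le M \<mu>) I
    (relevant_claims M \<mu>)"
proof -
  let ?H = "L1_space (mixture M \<mu>)" and ?\<tau> = "L1_topology (mixture M \<mu>)"
  have int: "integrable Q X" if "X \<in> ?H" for X
    using Q that by (simp add: martingale_measure_def)
  have cont: "continuous_map ?\<tau> euclideanreal (\<lambda>X. \<integral>\<omega>. X \<omega> \<partial>Q)"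
    using Q by (simp add: martingale_measure_def)
  define pref where "pref X Y \<longleftrightarrow> (\<integral>\<omega>. X \<omega> \<partial>Q) \<le> (\<integral>\<omega>. Y \<omega> \<partial>Q)" for X Y :: "'a \<Rightarrow> real"
  have "pref \<in> agents ?H ?\<tau> (prior_le M \<mu>)"
    unfolding agents_def mem_Collect_eq
  proof (intro conjI allI ballI impI)
    show "transp_on ?H pref"
      by (rule transp_onI) (auto simp: pref_def)
  next
    fix X Y assume "X \<in> ?H" "Y \<in> ?H"
    then show "pref X Y \<or> pref Y X" by (auto simp: pref_def)
  next
    fix X Y assume XY: "X \<in> ?H" "Y \<in> ?H" "prior_le M \<mu> X Y"
    \<comment> \<open>Unfolding \<open>prior_le\<close> turns \<open>X \<le> Y\<close> into
      \<open>0 \<le> Y - X\<close>, so monotonicity reduces to positivity.\<close>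
    have "0 \<le> (\<integral>\<omega>. Y \<omega> - X \<omega> \<partial>Q)"
      using Q XY by (auto simp: martingale_measure_def prior_le_def L1_space_def)
    then show "pref X Y" using int XY by (simp add: pref_def)
  next
    fix X Y Z and u :: real
    assume XYZ: "X \<in> ?H" "Y \<in> ?H" "Z \<in> ?H" and u: "u \<in> {0..1}" and le: "pref X Y" "pref X Z"
    let ?E = "\<lambda>X. \<integral>\<omega>. X \<omega> \<partial>Q"
    have "?E X = u * ?E X + (1 - u) * ?E X" by (simp add: algebra_simps)
    also have "\<dots> \<le> u * ?E Y + (1 - u) * ?E Z"
      using u le by (intro add_mono mult_left_mono) (auto simp: pref_def)
    also have "\<dots> = ?E (\<lambda>\<omega>. u * Y \<omega> + (1 - u) * Z \<omega>)"
      using int XYZ by simp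
    finally show "pref X (\<lambda>\<omega>. u * Y \<omega> + (1 - u) * Z \<omega>)" by (simp add: pref_def)
  next
    fix Xs X Y assume lim: "limitin ?\<tau> Xs X sequentially" and le: "\<forall>n. pref (Xs n) Y"
    have "(\<lambda>n. \<integral>\<omega>. Xs n \<omega> \<partial>Q) \<longlonglongrightarrow> (\<integral>\<omega>. X \<omega> \<partial>Q)"
      using continuous_map_limit[OF cont lim] by (simp add: o_def)
    then show "pref X Y"
      using le by (auto simp: pref_def intro: LIMSEQ_le_const2)
  qed
  moreover have "pref l (\<lambda>_. 0)" if "l \<in> I" for l
    using Q that by (simp add: martingale_measure_def pref_def)
  moreover have "pref (\<lambda>_. 0) X \<and> \<not> pref X (\<lambda>_. 0)" if "X \<in> relevant_claims M \<mu>" for X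
  proof -
    have "0 < (\<integral>\<omega>. X \<omega> \<partial>Q)"
      using Q that unfolding relevant_claims_eq[OF prior] martingale_measure_def by blast
    then show ?thesis by (simp add: pref_def)
  qed
  ultimately show ?thesis
    unfolding viable_def by (intro exI[of _ "{pref}"]) auto
qed

text \<open>By lower semi-continuity no relevant claim is a limit of claims dominated by net trades,
  since every agent of a viable family weakly prefers \<open>0\<close> to those.\<close>

lemma viable_imp_distance_pos:
  assumes prior: "second_order_prior M \<mu>"
    and viable: "viable (L1_space (mixture M \<mu>)) (L1_topology (mixture M \<mu>)) (prior_le M \<mu>) I
      (relevant_claims M \<mu>)"
    and I: "I \<subseteq> L1_space (mixture M \<mu>)"
    and R: "R \<in> relevant_claims M \<mu>"
  obtains e where "0 < e"
    "\<And>l Z. l \<in> I \<Longrightarrow> Z \<in> L1_space (mixture M \<mu>) \<Longrightarrow> (\<And>\<omega>. 0 \<le> Z \<omega>) \<Longrightarrow>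
      e \<le> (\<integral>\<omega>. \<bar>R \<omega> - (l \<omega> - Z \<omega>)\<bar> \<partial>mixture M \<mu>)"
proof (rule ccontr)
  let ?N = "mixture M \<mu>"
  let ?H = "L1_space ?N"
  assume "\<not> thesis"
  with that have near: "\<exists>l\<in>I. \<exists>Z\<in>?H. (\<forall>\<omega>. 0 \<le> Z \<omega>) \<and> (\<integral>\<omega>. \<bar>R \<omega> - (l \<omega> - Z \<omega>)\<bar> \<partial>?N) < e"
    if "0 < e" for e
    using \<open>0 < e\<close> by (meson not_le)
  have "0 < inverse (real (Suc n))" for n by simp
  from near[OF this] have "\<exists>l Z. l \<in> I \<and> Z \<in> ?H \<and> (\<forall>\<omega>. 0 \<le> Z \<omega>) \<and>
      (\<integral>\<omega>. \<bar>R \<omega> - (l \<omega> - Z \<omega>)\<bar> \<partial>?N) < inverse (real (Suc n))" for n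
    by blast
  then obtain l Z where l: "\<And>n. l n \<in> I" and Z: "\<And>n. Z n \<in> ?H" "\<And>n \<omega>. 0 \<le> Z n \<omega>"
    and small: "\<And>n. (\<integral>\<omega>. \<bar>R \<omega> - (l n \<omega> - Z n \<omega>)\<bar> \<partial>?N) < inverse (real (Suc n))"
    by metis
  have lH: "l n \<in> ?H" for n using l I by blast
  have RH: "R \<in> ?H" using R by (simp add: relevant_claims_def)
  have zero: "(\<lambda>_. 0) \<in> ?H" by (simp add: L1_space_def)
  define Xs where "Xs n \<omega> = l n \<omega> - Z n \<omega>" for n \<omega>
  have Xs: "Xs n \<in> ?H" for n
    using lH[of n] Z(1)[of n] by (simp add: L1_space_def Xs_def[abs_def])
  obtain pref where pref: "pref \<in> agents ?H (L1_topology ?N) (prior_le M \<mu>)"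
    and trade: "\<And>l. l \<in> I \<Longrightarrow> pref l (\<lambda>_. 0)" and notR: "\<not> pref R (\<lambda>_. 0)"
    using viable R unfolding viable_def by blast
  have "pref (Xs n) (\<lambda>_. 0)" for n
  proof -
    have "prior_le M \<mu> (Xs n) (l n)"
      using Xs[of n] lH[of n] Z(2)
      by (subst prior_le_iff_AE[OF prior])
        (auto simp: L1_space_def Xs_def dest: borel_measurable_integrable)
    then have "pref (Xs n) (l n)" using pref Xs lH by (simp add: agents_def)
    moreover have "transp_on ?H pref" using pref by (simp add: agents_def)
    ultimately show ?thesis using transp_onD[OF _ Xs lH zero] trade[OF l] by blast
  qed
  moreover have "limitin (L1_topology ?N) Xs R sequentially"
  proof (rule limitin_L1_topology)
    show "(\<lambda>n. \<integral>\<omega>. \<bar>Xs n \<omega> - R \<omega>\<bar> \<partial>?N) \<longlonglongrightarrow> 0"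
      by (rule tendsto_sandwich[OF _ _ tendsto_const LIMSEQ_inverse_real_of_nat])
        (use small in \<open>auto simp: Xs_def abs_minus_commute intro!: always_eventually less_imp_le\<close>)
  qed (use RH Xs in auto)
  moreover have "pref X (\<lambda>_. 0)"
    if "range Xs \<subseteq> ?H" "limitin (L1_topology ?N) Xs X sequentially"
      "\<forall>n. pref (Xs n) (\<lambda>_. 0)" for Xs X
    using pref zero that by (simp add: agents_def)
  ultimately have "pref R (\<lambda>_. 0)" using Xs by (metis image_subsetI)
  with notR show False ..
qed

section \<open>From positive distance to an almost everywhere positive pricing density\<close>

definition trading_cone :: "('a \<Rightarrow> real) set \<Rightarrow> bool" where
  "trading_cone I \<longleftrightarrow> (\<lambda>_. 0) \<in> I \<and> (\<forall>l\<in>I. \<forall>k\<in>I. (\<lambda>\<omega>. l \<omega> + k \<omega>) \<in> I) \<and>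
     (\<forall>c>0. \<forall>l\<in>I. (\<lambda>\<omega>. c * l \<omega>) \<in> I)"

text \<open>The cone \<open>K\<close> of trades minus nonnegative claims encodes two requirements at
  once: nonpositivity of \<open>f\<close> on trades is the pricing inequality, and nonpositivity on
  \<open>- Z\<close> makes \<open>f\<close> a positive functional, as a density needs. The resulting
  \<open>D\<close> depends on \<open>R\<close> and may vanish elsewhere.\<close>

lemma viable_imp_pricing_density:
  assumes prior: "second_order_prior M \<mu>"
    and viable: "viable (L1_space (mixture M \<mu>)) (L1_topology (mixture M \<mu>)) (prior_le M \<mu>) I
      (relevant_claims M \<mu>)"
    and I: "I \<subseteq> L1_space (mixture M \<mu>)" and cone: "trading_cone I"
    and R: "R \<in> relevant_claims M \<mu>"
  obtains D where "D \<in> borel_measurable M" "\<And>\<omega>. 0 \<le> D \<omega>" "\<And>\<omega>. D \<omega> \<le> 1"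
    "\<And>l. l \<in> I \<Longrightarrow> (\<integral>\<omega>. D \<omega> * l \<omega> \<partial>mixture M \<mu>) \<le> 0"
    "0 < (\<integral>\<omega>. D \<omega> * R \<omega> \<partial>mixture M \<mu>)"
proof -
  let ?N = "mixture M \<mu>"
  let ?H = "L1_space ?N"
  interpret N: prob_space ?N by (rule prob_space_mixture[OF prior])
  define K where "K = {l - Z | l Z. l \<in> I \<and> Z \<in> ?H \<and> (\<forall>\<omega>. 0 \<le> Z \<omega>)}"
  obtain e where e: "0 < e"
    "\<And>l Z. l \<in> I \<Longrightarrow> Z \<in> ?H \<Longrightarrow> (\<And>\<omega>. 0 \<le> Z \<omega>) \<Longrightarrow> e \<le> (\<integral>\<omega>. \<bar>R \<omega> - (l \<omega> - Z \<omega>)\<bar> \<partial>?N)"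
    using viable_imp_distance_pos[OF prior viable I R] by blast
  have H: "subspace ?H"
    by (auto simp: subspace_def L1_space_def plus_fun_def zero_fun_def scaleR_fun_def)
  have n: "sublinear_on ?H (\<lambda>X. \<integral>\<omega>. \<bar>X \<omega>\<bar> \<partial>?N)"
  proof (rule sublinear_onI)
    fix X Y assume "X \<in> ?H" "Y \<in> ?H"
    then have "integrable ?N X" "integrable ?N Y" by (auto simp: L1_space_def)
    then have "(\<integral>\<omega>. \<bar>X \<omega> + Y \<omega>\<bar> \<partial>?N) \<le> (\<integral>\<omega>. \<bar>X \<omega>\<bar> + \<bar>Y \<omega>\<bar> \<partial>?N)"
      by (intro integral_mono) auto
    with \<open>integrable ?N X\<close> \<open>integrable ?N Y\<close>
    show "(\<integral>\<omega>. \<bar>(X + Y) \<omega>\<bar> \<partial>?N) \<le> (\<integral>\<omega>. \<bar>X \<omega>\<bar> \<partial>?N) + (\<integral>\<omega>. \<bar>Y \<omega>\<bar> \<partial>?N)"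
      by (simp add: plus_fun_def)
  qed (simp add: scaleR_fun_def abs_mult)
  have KI: "l \<in> K" if "l \<in> I" for l
    using that unfolding K_def mem_Collect_eq
    by - (rule exI[of _ l], rule exI[of _ "\<lambda>_. 0"], simp add: L1_space_def fun_eq_iff)
  have KZ: "- Z \<in> K" if "Z \<in> ?H" "\<And>\<omega>. 0 \<le> Z \<omega>" for Z
  proof -
    have "- Z = (\<lambda>_. 0) - Z" by (simp add: fun_eq_iff)
    then show ?thesis using that cone unfolding K_def trading_cone_def by blast
  qed
  have "0 \<in> I" using cone by (simp add: trading_cone_def zero_fun_def)
  obtain f where f: "\<And>X Y. X \<in> ?H \<Longrightarrow> Y \<in> ?H \<Longrightarrow> f (X + Y) = f X + f Y"
      "\<And>c X. X \<in> ?H \<Longrightarrow> f (c *\<^sub>R X) = c * f X"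
      "\<And>X. X \<in> ?H \<Longrightarrow> f X \<le> (\<integral>\<omega>. \<bar>X \<omega>\<bar> \<partial>?N)" "\<And>k. k \<in> K \<Longrightarrow> f k \<le> 0" "0 < f R"
  proof (rule separation_from_cone[OF H n, where K = K and y = R and e = e])
    show "K \<subseteq> ?H" using I subspace_diff[OF H] by (auto simp: K_def)
    show "0 \<in> K" using KI \<open>0 \<in> I\<close> by blast
    show "R \<in> ?H" using R by (simp add: relevant_claims_def)
    show "e \<le> (\<integral>\<omega>. \<bar>(R - k) \<omega>\<bar> \<partial>?N)" if "k \<in> K" for k
      using that e(2) by (auto simp: K_def)
    show "k + k' \<in> K" if kk': "k \<in> K" "k' \<in> K" for k k'
    proof -
      obtain l Z l' Z' where *: "k = l - Z" "l \<in> I" "Z \<in> ?H" "\<forall>\<omega>. 0 \<le> Z \<omega>"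
        "k' = l' - Z'" "l' \<in> I" "Z' \<in> ?H" "\<forall>\<omega>. 0 \<le> Z' \<omega>"
        using kk' by (auto simp: K_def)
      have "l + l' \<in> I" "Z + Z' \<in> ?H" "\<forall>\<omega>. 0 \<le> (Z + Z') \<omega>"
        using * cone subspace_add[OF H] by (auto simp: trading_cone_def plus_fun_def)
      moreover have "k + k' = (l + l') - (Z + Z')" using * by simp
      ultimately show ?thesis unfolding K_def by blast
    qed
    show "c *\<^sub>R k \<in> K" if ck: "0 < c" "k \<in> K" for c k
    proof -
      obtain l Z where *: "k = l - Z" "l \<in> I" "Z \<in> ?H" "\<forall>\<omega>. 0 \<le> Z \<omega>"
        using ck by (auto simp: K_def)
      have "c *\<^sub>R l \<in> I" "c *\<^sub>R Z \<in> ?H" "\<forall>\<omega>. 0 \<le> (c *\<^sub>R Z) \<omega>"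
        using * cone ck subspace_scale[OF H] by (auto simp: trading_cone_def scaleR_fun_def)
      moreover have "c *\<^sub>R k = c *\<^sub>R l - c *\<^sub>R Z" using * by (simp add: scaleR_diff_right)
      ultimately show ?thesis unfolding K_def by blast
    qed
  qed (use e in auto)
  obtain D where D: "D \<in> borel_measurable ?N" "\<And>\<omega>. 0 \<le> D \<omega>" "\<And>\<omega>. D \<omega> \<le> 1"
    "\<And>X. integrable ?N X \<Longrightarrow> f X = (\<integral>\<omega>. D \<omega> * X \<omega> \<partial>?N)"
  proof (rule N.L1_dominated_functional_density[of f])
    show "f (\<lambda>\<omega>. X \<omega> + Y \<omega>) = f X + f Y" if "integrable ?N X" "integrable ?N Y" for X Y
      using f(1) that by (simp add: plus_fun_def L1_space_def)
    show "f (\<lambda>\<omega>. c * X \<omega>) = c * f X" if "integrable ?N X" for c X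
      using f(2) that by (simp add: scaleR_fun_def L1_space_def)
    show "f X \<le> (\<integral>\<omega>. \<bar>X \<omega>\<bar> \<partial>?N)" if "integrable ?N X" for X
      using f(3) that by (simp add: L1_space_def)
    show "0 \<le> f X" if "integrable ?N X" "\<And>\<omega>. 0 \<le> X \<omega>" for X
      using f(4)[OF KZ[of X]] f(2)[of X "- 1"] that by (simp add: L1_space_def)
  qed blast
  show ?thesis
  proof (rule that[of D])
    show "D \<in> borel_measurable M" using D(1) by measurable
    show "(\<integral>\<omega>. D \<omega> * l \<omega> \<partial>?N) \<le> 0" if "l \<in> I" for l
      using D(4)[of l] f(4)[OF KI[OF that]] I that by (auto simp: L1_space_def)
    show "0 < (\<integral>\<omega>. D \<omega> * R \<omega> \<partial>?N)"
      using D(4)[of R] f(5) R by (auto simp: L1_space_def relevant_claims_def)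
  qed (use D in auto)
qed

text \<open>The indicator of a set that is not null for the mixture is a relevant claim, hence some
  pricing density charges that set; this is what the exhaustion asks for. The rest is closure of the
  class under countable convex combinations.\<close>

lemma viable_imp_positive_pricing_density:
  assumes prior: "second_order_prior M \<mu>"
    and viable: "viable (L1_space (mixture M \<mu>)) (L1_topology (mixture M \<mu>)) (prior_le M \<mu>) I
      (relevant_claims M \<mu>)"
    and I: "I \<subseteq> L1_space (mixture M \<mu>)" and cone: "trading_cone I"
  obtains D where "D \<in> borel_measurable M" "\<And>\<omega>. 0 \<le> D \<omega>" "\<And>\<omega>. D \<omega> \<le> 1"
    "\<And>l. l \<in> I \<Longrightarrow> (\<integral>\<omega>. D \<omega> * l \<omega> \<partial>mixture M \<mu>) \<le> 0" "AE \<omega> in mixture M \<mu>. 0 < D \<omega>"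
proof -
  let ?N = "mixture M \<mu>"
  interpret N: prob_space ?N by (rule prob_space_mixture[OF prior])
  define \<D> where "\<D> = {D \<in> borel_measurable ?N. (\<forall>\<omega>. 0 \<le> D \<omega> \<and> D \<omega> \<le> 1) \<and>
    (\<forall>l\<in>I. (\<integral>\<omega>. D \<omega> * l \<omega> \<partial>?N) \<le> 0)}"
  obtain D where "D \<in> \<D>" "AE \<omega> in ?N. 0 < D \<omega>"
  proof (rule N.ex_AE_positive_element[of \<D>])
    have "(\<lambda>_. 0) \<in> \<D>" by (simp add: \<D>_def)
    then show "\<D> \<noteq> {}" by blast
    show "\<exists>D\<in>\<D>. 0 < (\<integral>\<omega>. D \<omega> * indicator A \<omega> \<partial>?N)" if A: "A \<in> sets ?N" "0 < measure ?N A" for A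
    proof -
      have [measurable]: "A \<in> sets M" using A by simp
      have "\<not> (AE \<omega> in ?N. indicator A \<omega> \<le> (0::real))"
        using A N.prob_eq_0[of A] by (simp add: indicator_def not_le)
      then have "indicator A \<in> relevant_claims M \<mu>"
        using A by (simp add: relevant_claims_eq[OF prior] prior_le_iff_AE[OF prior] L1_space_def
            N.emeasure_eq_measure)
      then obtain D where "D \<in> borel_measurable M" "\<And>\<omega>. 0 \<le> D \<omega>" "\<And>\<omega>. D \<omega> \<le> 1"
        "\<And>l. l \<in> I \<Longrightarrow> (\<integral>\<omega>. D \<omega> * l \<omega> \<partial>?N) \<le> 0" "0 < (\<integral>\<omega>. D \<omega> * indicator A \<omega> \<partial>?N)"
        using viable_imp_pricing_density[OF prior viable I cone] by blast
      then show ?thesis by (intro bexI[of _ D]) (auto simp: \<D>_def)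
    qed
    fix Ds :: "nat \<Rightarrow> 'a \<Rightarrow> real" assume Ds: "\<And>n. Ds n \<in> \<D>"
    have [measurable]: "Ds n \<in> borel_measurable ?N" for n using Ds[of n] by (simp add: \<D>_def)
    have range: "0 \<le> Ds n \<omega>" "Ds n \<omega> \<le> 1" for n \<omega> using Ds[of n] by (simp_all add: \<D>_def)
    have le: "(1/2) ^ Suc n * Ds n \<omega> \<le> (1/2) ^ Suc n" for n \<omega>
      using range by (simp add: power_one_over divide_right_mono)
    have summable: "summable (\<lambda>n. (1/2) ^ Suc n * Ds n \<omega>)" for \<omega>
      by (rule summable_comparison_test'[OF sums_summable[OF power_half_series]])
        (use range le in \<open>auto simp: abs_mult\<close>)
    let ?S = "\<lambda>\<omega>. \<Sum>n. (1/2) ^ Suc n * Ds n \<omega>"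
    have "?S \<omega> \<le> 1" for \<omega>
      using suminf_le[OF le summable sums_summable[OF power_half_series]]
        sums_unique[OF power_half_series] by simp
    moreover have "0 \<le> ?S \<omega>" for \<omega>
      using range by (intro suminf_nonneg summable) simp
    moreover have "(\<integral>\<omega>. ?S \<omega> * l \<omega> \<partial>?N) \<le> 0" if l: "l \<in> I" for l
    proof -
      have l_int [measurable]: "integrable ?N l" using l I by (auto simp: L1_space_def)
      have Dl: "integrable ?N (\<lambda>\<omega>. Ds n \<omega> * l \<omega>)" for n
      proof (rule Bochner_Integration.integrable_bound[OF l_int])
        show "AE \<omega> in ?N. norm (Ds n \<omega> * l \<omega>) \<le> norm (l \<omega>)"
          using range by (auto simp: abs_mult intro!: mult_left_le_one_le)
      qed measurable
      let ?F = "\<lambda>n \<omega>. (1/2) ^ Suc n * (Ds n \<omega> * l \<omega>)"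
      have F: "integrable ?N (?F n)" for n using Dl by simp
      \<comment> \<open>Sum and integral may be interchanged because the bound
        \<open>Ds n \<le> 1\<close> makes the L1 norms of the terms at most
        \<open>(1/2) ^ Suc n\<close> times that of \<open>l\<close>.\<close>
      have F_sums: "(\<lambda>n. \<integral>\<omega>. ?F n \<omega> \<partial>?N) sums (\<integral>\<omega>. (\<Sum>n. ?F n \<omega>) \<partial>?N)"
      proof (rule sums_integral[OF F])
        have "summable (\<lambda>n. norm (?F n \<omega>))" for \<omega>
          using summable_mult2[OF summable[of \<omega>], of "\<bar>l \<omega>\<bar>"] range
          by (simp add: abs_mult mult.assoc)
        then show "AE \<omega> in ?N. summable (\<lambda>n. norm (?F n \<omega>))" by simp
        show "summable (\<lambda>n. \<integral>\<omega>. norm (?F n \<omega>) \<partial>?N)"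
        proof (rule summable_comparison_test')
          show "summable (\<lambda>n. (1/2) ^ Suc n * (\<integral>\<omega>. \<bar>l \<omega>\<bar> \<partial>?N))"
            by (intro summable_mult2 sums_summable[OF power_half_series])
          fix n :: nat assume "0 \<le> n"
          have "(\<integral>\<omega>. norm (?F n \<omega>) \<partial>?N) \<le> (\<integral>\<omega>. (1/2) ^ Suc n * \<bar>l \<omega>\<bar> \<partial>?N)"
            using range l_int
            by (intro integral_mono integrable_norm F)
              (auto simp: abs_mult power_one_over intro!: divide_right_mono mult_left_le_one_le)
          then show "norm (\<integral>\<omega>. norm (?F n \<omega>) \<partial>?N) \<le> (1/2) ^ Suc n * (\<integral>\<omega>. \<bar>l \<omega>\<bar> \<partial>?N)"
            by simp
        qed
      qed
      have F_le: "(\<integral>\<omega>. ?F n \<omega> \<partial>?N) \<le> 0" for n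
        using Ds[of n] l by (simp add: \<D>_def mult_nonneg_nonpos)
      have "(\<integral>\<omega>. (\<Sum>n. ?F n \<omega>) \<partial>?N) \<le> 0"
        by (rule sums_le[OF F_le F_sums sums_zero])
      moreover have "(\<Sum>n. ?F n \<omega>) = ?S \<omega> * l \<omega>" for \<omega>
        using suminf_mult2[OF summable[of \<omega>], of "l \<omega>"] by (simp add: mult.assoc)
      ultimately show ?thesis by simp
    qed
    ultimately show "?S \<in> \<D>" by (simp add: \<D>_def)
  qed (auto simp: \<D>_def)
  then show ?thesis by (intro that[of D]) (auto simp: \<D>_def)
qed

text \<open>Division by \<open>c\<close>, the mean of \<open>D\<close> under the mixture, makes Q a
  probability measure. The bound \<open>D \<le> 1\<close> makes every claim Q-integrable and its
  expectation Lipschitz with constant \<open>1 / c\<close>; positivity of \<open>D\<close> almost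
  everywhere gives strict positivity on relevant claims.\<close>

lemma positive_density_martingale_measure:
  assumes prior: "second_order_prior M \<mu>"
    and D [measurable]: "D \<in> borel_measurable M" and D_range: "\<And>\<omega>. 0 \<le> D \<omega>" "\<And>\<omega>. D \<omega> \<le> 1"
    and trade: "\<And>l. l \<in> I \<Longrightarrow> (\<integral>\<omega>. D \<omega> * l \<omega> \<partial>mixture M \<mu>) \<le> 0"
    and pos: "AE \<omega> in mixture M \<mu>. 0 < D \<omega>"
    and I: "I \<subseteq> L1_space (mixture M \<mu>)"
  obtains Q D' where "martingale_measure M (L1_space (mixture M \<mu>)) (L1_topology (mixture M \<mu>))
      (prior_le M \<mu>) I Q" "state_price_density M \<mu> Q D'"
proof -
  let ?N = "mixture M \<mu>"
  let ?H = "L1_space ?N"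
  interpret N: prob_space ?N by (rule prob_space_mixture[OF prior])
  have prod_int: "integrable ?N (\<lambda>\<omega>. D \<omega> * X \<omega>)" if "integrable ?N X" for X
  proof (rule Bochner_Integration.integrable_bound[OF that])
    show "AE \<omega> in ?N. norm (D \<omega> * X \<omega>) \<le> norm (X \<omega>)"
      using D_range by (auto simp: abs_mult intro!: mult_left_le_one_le)
  qed (use that in measurable)
  have D_int: "integrable ?N D" using prod_int[of "\<lambda>_. 1"] by simp
  \<comment> \<open>Used twice: with the constant claim 1 it gives \<open>0 < c\<close>, with a
    general claim the strict positivity of the functional.\<close>
  have strict: "0 < (\<integral>\<omega>. D \<omega> * X \<omega> \<partial>?N)"
    if X: "integrable ?N X" "AE \<omega> in ?N. 0 \<le> X \<omega>" "\<not> (AE \<omega> in ?N. X \<omega> \<le> 0)" for X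
  proof -
    have nn: "AE \<omega> in ?N. 0 \<le> D \<omega> * X \<omega>"
      using X(2) by eventually_elim (simp add: D_range)
    have "(\<integral>\<omega>. D \<omega> * X \<omega> \<partial>?N) \<noteq> 0"
    proof
      assume "(\<integral>\<omega>. D \<omega> * X \<omega> \<partial>?N) = 0"
      then have "AE \<omega> in ?N. D \<omega> * X \<omega> = 0"
        using integral_nonneg_eq_0_iff_AE[OF prod_int[OF X(1)] nn] by simp
      with pos have "AE \<omega> in ?N. X \<omega> \<le> 0" by eventually_elim auto
      with X(3) show False ..
    qed
    then show ?thesis using integral_nonneg_AE[OF nn] by simp
  qed
  define c where "c = (\<integral>\<omega>. D \<omega> \<partial>?N)"
  have c: "0 < c"
    using strict[of "\<lambda>_. 1"] by (simp add: c_def)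
  define Q where "Q = density ?N (\<lambda>\<omega>. ennreal (D \<omega> / c))"
  have Q_int: "integrable Q X" if "X \<in> ?H" for X
    unfolding Q_def using that prod_int[of X] D_range c
    by (subst integrable_density) (auto simp: L1_space_def dest: borel_measurable_integrable)
  have E_Q: "(\<integral>\<omega>. X \<omega> \<partial>Q) = (\<integral>\<omega>. D \<omega> * X \<omega> \<partial>?N) / c" if "X \<in> ?H" for X
    unfolding Q_def using that D_range c
    by (subst integral_density) (auto simp: L1_space_def dest: borel_measurable_integrable)
  have meas: "X \<in> borel_measurable M" if "X \<in> ?H" for X
    using that by (auto simp: L1_space_def dest: borel_measurable_integrable)
  have "emeasure Q (space Q) = (\<integral>\<^sup>+\<omega>. ennreal (D \<omega> / c) \<partial>?N)"
    by (auto simp: Q_def emeasure_density intro!: nn_integral_cong)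
  also have "\<dots> = ennreal (\<integral>\<omega>. D \<omega> / c \<partial>?N)"
    using D_int D_range c by (intro nn_integral_eq_integral) auto
  also have "\<dots> = 1" using c by (simp add: c_def)
  finally have prob: "prob_space Q" by (rule prob_spaceI)
  show ?thesis
  proof (rule that)
    \<comment> \<open>\<open>nn_integral_mixture\<close> splits the integral against the mixture
      into the iterated one over models that the displayed formula requires.\<close>
    show "state_price_density M \<mu> Q (\<lambda>\<omega>. D \<omega> / c)"
      using D_range c unfolding state_price_density_def Q_def
      by (auto simp: emeasure_density nn_integral_mixture[OF prior])
    show "martingale_measure M ?H (L1_topology ?N) (prior_le M \<mu>) I Q"
      unfolding martingale_measure_def
    proof (intro conjI ballI impI)
      show "continuous_map (L1_topology ?N) euclideanreal (\<lambda>X. \<integral>\<omega>. X \<omega> \<partial>Q)"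
      proof (rule continuous_map_L1_topology[where C = "1 / c"])
        fix X Y assume XY: "X \<in> ?H" "Y \<in> ?H"
        then have int: "integrable ?N X" "integrable ?N Y" by (auto simp: L1_space_def)
        then have diff: "integrable ?N (\<lambda>\<omega>. Y \<omega> - X \<omega>)" by simp
        have "\<bar>\<integral>\<omega>. D \<omega> * (Y \<omega> - X \<omega>) \<partial>?N\<bar> \<le> (\<integral>\<omega>. \<bar>D \<omega> * (Y \<omega> - X \<omega>)\<bar> \<partial>?N)"
          by (rule integral_abs_bound)
        also have "\<dots> \<le> (\<integral>\<omega>. \<bar>Y \<omega> - X \<omega>\<bar> \<partial>?N)"
          using prod_int[OF diff] prod_int[OF integrable_abs[OF diff]] diff D_range
          by (intro integral_mono) (auto simp: abs_mult intro!: mult_left_le_one_le)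
        finally have "\<bar>(\<integral>\<omega>. D \<omega> * Y \<omega> \<partial>?N) - (\<integral>\<omega>. D \<omega> * X \<omega> \<partial>?N)\<bar> \<le> (\<integral>\<omega>. \<bar>Y \<omega> - X \<omega>\<bar> \<partial>?N)"
          using prod_int[OF int(1)] prod_int[OF int(2)] by (simp add: right_diff_distrib)
        then show "\<bar>(\<integral>\<omega>. Y \<omega> \<partial>Q) - (\<integral>\<omega>. X \<omega> \<partial>Q)\<bar> \<le> 1 / c * (\<integral>\<omega>. \<bar>Y \<omega> - X \<omega>\<bar> \<partial>?N)"
          using c XY by (simp add: E_Q diff_divide_distrib[symmetric] abs_divide divide_right_mono)
      qed (use c in simp)
    next
      fix X assume X: "X \<in> ?H" "prior_le M \<mu> (\<lambda>_. 0) X"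
      then have AE: "AE \<omega> in ?N. 0 \<le> X \<omega>" using prior_le_iff_AE[OF prior] meas by simp
      then have "AE \<omega> in ?N. 0 \<le> D \<omega> * X \<omega>" by eventually_elim (simp add: D_range)
      then show "0 \<le> (\<integral>\<omega>. X \<omega> \<partial>Q)" using c X by (simp add: E_Q integral_nonneg_AE)
      assume "\<not> prior_le M \<mu> X (\<lambda>_. 0)"
      then have "\<not> (AE \<omega> in ?N. X \<omega> \<le> 0)" using prior_le_iff_AE[OF prior] meas X by simp
      then show "0 < (\<integral>\<omega>. X \<omega> \<partial>Q)"
        using strict AE c X by (simp add: E_Q L1_space_def)
    next
      show "(\<integral>\<omega>. l \<omega> \<partial>Q) \<le> 0" if "l \<in> I" for l
        using that I trade[OF that] c by (auto simp: E_Q divide_nonpos_pos)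
    qed (use prob Q_int in \<open>auto simp: Q_def\<close>)
  qed
qed

lemma trading_cone_net_trades:
  fixes S :: "nat \<Rightarrow> 'a \<Rightarrow> real ^ 'j"
  shows "trading_cone (net_trades M (L1_space N) T F S)"
  unfolding trading_cone_def
proof (intro conjI ballI allI impI)
  show "(\<lambda>_. 0) \<in> net_trades M (L1_space N) T F S"
    by (auto simp: net_trades_def L1_space_def intro!: exI[of _ "\<lambda>_ _. 0"])
next
  fix l k assume "l \<in> net_trades M (L1_space N) T F S" "k \<in> net_trades M (L1_space N) T F S"
  then obtain \<theta> \<eta> :: "nat \<Rightarrow> 'a \<Rightarrow> real ^ 'j" where
    "\<forall>t\<in>{1..T}. \<theta> t \<in> borel_measurable (F (t - 1))"
    "\<forall>\<omega>\<in>space M. l \<omega> = (\<Sum>t=1..T. \<theta> t \<omega> \<bullet> (S t \<omega> - S (t - 1) \<omega>))"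
    "\<forall>t\<in>{1..T}. \<eta> t \<in> borel_measurable (F (t - 1))"
    "\<forall>\<omega>\<in>space M. k \<omega> = (\<Sum>t=1..T. \<eta> t \<omega> \<bullet> (S t \<omega> - S (t - 1) \<omega>))"
    "integrable N l" "integrable N k"
    by (auto simp: net_trades_def L1_space_def)
  then show "(\<lambda>\<omega>. l \<omega> + k \<omega>) \<in> net_trades M (L1_space N) T F S"
    unfolding net_trades_def L1_space_def
    by (auto simp: inner_add_left sum.distrib intro!: borel_measurable_add exI[of _ "\<lambda>t \<omega>. \<theta> t \<omega> + \<eta> t \<omega>"])
next
  fix c :: real and l assume "l \<in> net_trades M (L1_space N) T F S"
  then obtain \<theta> :: "nat \<Rightarrow> 'a \<Rightarrow> real ^ 'j" where
    "\<forall>t\<in>{1..T}. \<theta> t \<in> borel_measurable (F (t - 1))"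
    "\<forall>\<omega>\<in>space M. l \<omega> = (\<Sum>t=1..T. \<theta> t \<omega> \<bullet> (S t \<omega> - S (t - 1) \<omega>))" "integrable N l"
    by (auto simp: net_trades_def L1_space_def)
  then show "(\<lambda>\<omega>. c * l \<omega>) \<in> net_trades M (L1_space N) T F S"
    unfolding net_trades_def L1_space_def
    by (auto simp: sum_distrib_left intro!: borel_measurable_scaleR exI[of _ "\<lambda>t \<omega>. c *\<^sub>R \<theta> t \<omega>"])
qed

theorem proposition3p6:
  fixes M :: "'a measure" and \<mu> :: "'a measure measure"
    and T :: nat and F :: "nat \<Rightarrow> 'a measure" and S :: "nat \<Rightarrow> 'a \<Rightarrow> real ^ 'j"
  assumes "standard_borel_space M"
    and "second_order_prior M \<mu>"
    and "1 \<le> T"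
    and "filtration_upto M T F"
    and "price_process M T F S"
  shows "let H = L1_space (mixture M \<mu>);
             \<tau> = L1_topology (mixture M \<mu>);
             le = prior_le M \<mu>;
             I = net_trades M H T F S
         in viable H \<tau> le I (relevant_claims M \<mu>) \<longleftrightarrow>
            (\<exists>Q D. martingale_measure M H \<tau> le I Q \<and> state_price_density M \<mu> Q D)"
proof -
  let ?H = "L1_space (mixture M \<mu>)" and ?\<tau> = "L1_topology (mixture M \<mu>)"
  let ?I = "net_trades M ?H T F S"
  have I: "?I \<subseteq> ?H" by (auto simp: net_trades_def)
  have "\<exists>Q D. martingale_measure M ?H ?\<tau> (prior_le M \<mu>) ?I Q \<and> state_price_density M \<mu> Q D"
    if viable: "viable ?H ?\<tau> (prior_le M \<mu>) ?I (relevant_claims M \<mu>)"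
  proof -
    obtain D where "D \<in> borel_measurable M" "\<And>\<omega>. 0 \<le> D \<omega>" "\<And>\<omega>. D \<omega> \<le> 1"
      "\<And>l. l \<in> ?I \<Longrightarrow> (\<integral>\<omega>. D \<omega> * l \<omega> \<partial>mixture M \<mu>) \<le> 0" "AE \<omega> in mixture M \<mu>. 0 < D \<omega>"
      using viable_imp_positive_pricing_density[OF assms(2) viable I trading_cone_net_trades]
      by blast
    from positive_density_martingale_measure[OF assms(2) this I] show ?thesis by blast
  qed
  then show ?thesis
    using martingale_measure_imp_viable[OF assms(2)] unfolding Let_def by blast
qed

end
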